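(* Let $\Omega\subset\mathbb{R}^2$ be a bounded simply connected domain whose boundary $\partial\Omega$ is connected and of class $C^{3,\alpha}$. Let $\widetilde\gamma,Q\in\mathbb{R}$, $\beta>0$, $q>0$ be constants and suppose that $(\widetilde\psi_1,\widetilde\psi_2)$ solves $$\begin{cases}\Delta\widetilde\psi_1=\widetilde\gamma&\text{in }\Omega,\\ \Delta\widetilde\psi_2=0&\text{in }\mathbb{R}^2\setminus\overline\Omega,\\ \widetilde\psi_1=\widetilde\psi_2=0&\text{on }\partial\Omega,\\ |\nabla\widetilde\psi_1|^2+\beta\mathcal{K}-q|\nabla\widetilde\psi_2|^2=Q&\text{on }\partial\Omega,\\ |\nabla\widetilde\psi_2|\to0&\text{as }|x|\to+\infty,\end{cases}$$ and that there exist constants $m_1,m_2\in\mathbb{R}$ such that $$\partial_{\nu\nu}\widetilde\psi_1=m_1,\qquad \partial_{\nu\nu}\widetilde\psi_2=m_2\qquad\text{on }\partial\Omega.$$ Then the curvature $\mathcal{K}$ is constant on $\partial\Omega$. Consequently, $\Omega$ is a disk. Moreover, $\widetilde\psi_1$ is radially symmetric with respect to the center of $\Omega$. If the logarithmic coefficient of $\widetilde\psi_2$ at infinity is fixed, then $\widetilde\psi_2$ is also radially symmetric with respect to the same center.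
   Context: $0<\alpha<1$. $\nu$ is the unit normal on $\partial\Omega$ pointing outward from $\Omega$, $\partial_{\nu\nu}u=\nu^TD^2u\,\nu$, and $\mathcal{K}$ is the curvature of $\partial\Omega$, with the sign convention that circles have positive curvature. The functions $\widetilde\psi_1,\widetilde\psi_2$ are of class $C^2$ up to $\partial\Omega$ on their respective sides. The logarithmic coefficient of $\widetilde\psi_2$ at infinity is the constant $a$ such that $\widetilde\psi_2(x)=a\ln|x|+O(1)$ as $|x|\to\infty$. *)

theory Defs
  imports "HOL-Analysis.Analysis" "HOL-Library.Landau_Symbols"
begin

section \<open>Functions of class \<open>C\<^sup>2\<close> up to the boundary\<close>

definition gradient :: "(real^2 \<Rightarrow> real) \<Rightarrow> real^2 \<Rightarrow> real^2" where
  "gradient u x = (THE D. GDERIV u x :> D)"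

definition hessian :: "(real^2 \<Rightarrow> real) \<Rightarrow> real^2 \<Rightarrow> real^2^2" where
  "hessian u x = jacobian (gradient u) (at x)"

definition laplacian :: "(real^2 \<Rightarrow> real) \<Rightarrow> real^2 \<Rightarrow> real" where
  "laplacian u x = trace (hessian u x)"

text \<open>\<open>S\<close> is meant to be open; the first and second derivatives live on \<open>S\<close> and are required
  to extend continuously to the closure. Nothing is imposed on \<open>u\<close> outside the closure.\<close>

definition C2_up_to_boundary :: "(real^2) set \<Rightarrow> (real^2 \<Rightarrow> real) \<Rightarrow> bool" where
  "C2_up_to_boundary S u \<longleftrightarrow>
     (\<forall>x\<in>S. u differentiable (at x) \<and> gradient u differentiable (at x)) \<and>
     continuous_on (closure S) u \<and>
     (\<exists>G. continuous_on (closure S) G \<and> (\<forall>x\<in>S. G x = gradient u x)) \<and>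
     (\<exists>H. continuous_on (closure S) H \<and> (\<forall>x\<in>S. H x = hessian u x))"

text \<open>The boundary value at \<open>p\<close>, taken from the side \<open>S\<close>, of a quantity defined in \<open>S\<close>.\<close>

definition boundary_value :: "(real^2) set \<Rightarrow> (real^2 \<Rightarrow> 'b::t2_space) \<Rightarrow> real^2 \<Rightarrow> 'b" where
  "boundary_value S f p = Lim (at p within S) f"


section \<open>Planar domains with \<open>C\<^sup>k\<^sup>,\<^sup>\<alpha>\<close> boundary\<close>

definition Ck_holder_on :: "nat \<Rightarrow> real \<Rightarrow> real set \<Rightarrow> (real \<Rightarrow> real) \<Rightarrow> bool" where
  "Ck_holder_on k \<alpha> I f \<longleftrightarrow>
     (\<forall>j<k. \<forall>t\<in>I. (deriv ^^ j) f differentiable (at t)) \<and>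
     (\<exists>C. \<forall>s\<in>I. \<forall>t\<in>I. \<bar>(deriv ^^ k) f s - (deriv ^^ k) f t\<bar> \<le> C * \<bar>s - t\<bar> powr \<alpha>)"

text \<open>Near each boundary point \<open>p\<close>, in orthonormal coordinates with origin \<open>p\<close> and axes
  \<open>\<tau>\<close>, \<open>n\<close>, the set lies exactly below the graph of a \<open>C\<^sup>k\<^sup>,\<^sup>\<alpha>\<close> function.\<close>

definition Ck_holder_boundary :: "nat \<Rightarrow> real \<Rightarrow> (real^2) set \<Rightarrow> bool" where
  "Ck_holder_boundary k \<alpha> \<Omega> \<longleftrightarrow>
     (\<forall>p\<in>frontier \<Omega>. \<exists>\<tau> n r \<phi>.
        norm \<tau> = 1 \<and> norm n = 1 \<and> \<tau> \<bullet> n = 0 \<and> r > 0 \<and>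
        Ck_holder_on k \<alpha> {-r<..<r} \<phi> \<and>
        (\<forall>x\<in>ball p r. x \<in> \<Omega> \<longleftrightarrow> (x - p) \<bullet> n < \<phi> ((x - p) \<bullet> \<tau>)))"


section \<open>Normal and curvature of the boundary\<close>

definition regular_boundary_curve :: "(real^2) set \<Rightarrow> real^2 \<Rightarrow> (real \<Rightarrow> real^2) \<Rightarrow> bool" where
  "regular_boundary_curve \<Omega> p c \<longleftrightarrow>
     c 0 = p \<and>
     (\<forall>\<^sub>F t in nhds 0. c t \<in> frontier \<Omega> \<and> c differentiable (at t)) \<and>
     vector_derivative c (at 0) \<noteq> 0 \<and>
     (\<lambda>t. vector_derivative c (at t)) differentiable (at 0)"

definition outward_normal :: "(real^2) set \<Rightarrow> real^2 \<Rightarrow> real^2" where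
  "outward_normal \<Omega> p = (THE \<nu>. norm \<nu> = 1 \<and>
     (\<exists>c. regular_boundary_curve \<Omega> p c \<and> vector_derivative c (at 0) \<bullet> \<nu> = 0) \<and>
     (\<forall>\<^sub>F t in at_right 0. p - t *\<^sub>R \<nu> \<in> \<Omega> \<and> p + t *\<^sub>R \<nu> \<notin> closure \<Omega>))"

text \<open>For a regular curve \<open>c\<close> the normal part of \<open>c''\<close> is \<open>-\<K> \<bar>c'\<bar>\<^sup>2 \<nu>\<close> (for unit speed this is
  \<open>c'' = -\<K> \<nu>\<close>). With \<open>\<nu>\<close> outward, the boundary of a disk of radius \<open>R\<close> has
  curvature \<open>1/R\<close>. The value does not depend on the curve.\<close>

definition boundary_curvature :: "(real^2) set \<Rightarrow> real^2 \<Rightarrow> real" where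
  "boundary_curvature \<Omega> p = (THE \<kappa>. \<exists>c. regular_boundary_curve \<Omega> p c \<and>
     \<kappa> = - (vector_derivative (\<lambda>t. vector_derivative c (at t)) (at 0) \<bullet> outward_normal \<Omega> p)
           / (norm (vector_derivative c (at 0)))\<^sup>2)"

text \<open>\<open>\<partial>\<^sub>\<nu>\<^sub>\<nu> u = \<nu>\<^sup>T D\<^sup>2u \<nu>\<close> at a boundary point of \<open>\<Omega>\<close>, with \<open>D\<^sup>2u\<close> taken from the side \<open>S\<close> on
  which \<open>u\<close> lives; \<open>\<nu>\<close> points out of \<open>\<Omega>\<close> whichever side that is.\<close>

definition normal_second_derivative ::
    "(real^2) set \<Rightarrow> (real^2) set \<Rightarrow> (real^2 \<Rightarrow> real) \<Rightarrow> real^2 \<Rightarrow> real" where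
  "normal_second_derivative \<Omega> S u p =
     outward_normal \<Omega> p \<bullet> (boundary_value S (hessian u) p *v outward_normal \<Omega> p)"


section \<open>Radial symmetry\<close>

definition radially_symmetric_on :: "(real^2) set \<Rightarrow> real^2 \<Rightarrow> (real^2 \<Rightarrow> real) \<Rightarrow> bool" where
  "radially_symmetric_on S z u \<longleftrightarrow> (\<exists>f. \<forall>x\<in>S. u x = f (dist z x))"

end

theory Submission
  imports Defs
begin

text \<open>Differentiating the Dirichlet condition twice along the boundary turns the two equations
  \<open>\<Delta>\<psi>\<^sub>i = const\<close> into \<open>m\<^sub>1 + \<K> \<partial>\<^sub>\<nu>\<psi>\<^sub>1 = \<gamma>\<close> and \<open>m\<^sub>2 + \<K> \<partial>\<^sub>\<nu>\<psi>\<^sub>2 = 0\<close>. Multiplying the Bernoulli condition by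
  \<open>\<K>\<^sup>2\<close> therefore shows that \<open>\<K>\<close> is everywhere a root of the cubic
  \<open>\<beta> t\<^sup>3 - Q t\<^sup>2 + (\<gamma> - m\<^sub>1)\<^sup>2 - q m\<^sub>2\<^sup>2\<close>, so the continuous function \<open>\<K>\<close> is constant on the connected
  boundary. Then \<open>\<K> p - \<nu>(p)\<close> is constant along the boundary, which puts it on a circle, and the
  radial symmetry of both functions follows from the maximum principle.\<close>


section \<open>The maximum principle\<close>

text \<open>Both functions have derivatives only in the open sets on either side of the boundary; on
  the boundary itself there are just continuous extensions of gradient and Hessian. So the Dirichlet
  condition cannot be differentiated on the boundary curve directly. Normal and curvature, in turn,
  are descriptions over all admissible curves, so both must be computed in a graph chart and shown
  to be independent of the curve. Since \<beta> > 0 the cubic is not the zero polynomial; its roots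
  are finite in number, and a continuous function with finite range on a connected set is constant.
  Multiplying by the squared curvature avoids division, so points of zero curvature need no separate
  treatment; zero curvature is excluded only later, by boundedness of \<Omega>. Radial symmetry is
  uniqueness: with centre z and radius R the explicit solutions are \<gamma>/4 (|x - z|^2 - R^2)
  inside and a ln(|x - z|/R) outside. The outer domain is unbounded, and the logarithmic coefficient
  controls the growth of the difference. The predicate below keeps the gradient as an existential
  witness, so explicit functions and linear combinations are handled by exhibiting it.\<close>

definition has_laplacian_on :: "('a::euclidean_space \<Rightarrow> real) \<Rightarrow> ('a \<Rightarrow> real) \<Rightarrow> 'a set \<Rightarrow> bool" where
  "has_laplacian_on u l S \<longleftrightarrow> (\<exists>G. \<forall>x\<in>S. GDERIV u x :> G x \<and>
     (\<exists>G'. (G has_derivative G') (at x) \<and> (\<Sum>b\<in>Basis. G' b \<bullet> b) = l x))"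

section \<open>Linear combinations and model functions for the Laplacian\<close>

lemma has_laplacian_on_subset:
  "has_laplacian_on u l S \<Longrightarrow> T \<subseteq> S \<Longrightarrow> has_laplacian_on u l T"
  unfolding has_laplacian_on_def by blast

lemma has_laplacian_on_add:
  assumes "has_laplacian_on u k S" "has_laplacian_on v l S"
  shows "has_laplacian_on (\<lambda>x. u x + v x) (\<lambda>x. k x + l x) S"
proof -
  obtain G where G: "\<And>x. x \<in> S \<Longrightarrow> GDERIV u x :> G x \<and>
     (\<exists>G'. (G has_derivative G') (at x) \<and> (\<Sum>b\<in>Basis. G' b \<bullet> b) = k x)"
    using assms(1) unfolding has_laplacian_on_def by blast
  obtain H where H: "\<And>x. x \<in> S \<Longrightarrow> GDERIV v x :> H x \<and>
     (\<exists>G'. (H has_derivative G') (at x) \<and> (\<Sum>b\<in>Basis. G' b \<bullet> b) = l x)"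
    using assms(2) unfolding has_laplacian_on_def by blast
  show ?thesis
    unfolding has_laplacian_on_def
  proof (rule exI, intro ballI conjI)
    fix x assume x: "x \<in> S"
    show "GDERIV (\<lambda>x. u x + v x) x :> G x + H x"
      using GDERIV_add G[OF x] H[OF x] by blast
    obtain G' H' where "(G has_derivative G') (at x)" "(\<Sum>b\<in>Basis. G' b \<bullet> b) = k x"
      "(H has_derivative H') (at x)" "(\<Sum>b\<in>Basis. H' b \<bullet> b) = l x"
      using G[OF x] H[OF x] by blast
    then have "((\<lambda>x. G x + H x) has_derivative (\<lambda>h. G' h + H' h)) (at x) \<and>
      (\<Sum>b\<in>Basis. (G' b + H' b) \<bullet> b) = k x + l x"
      by (auto intro: has_derivative_add simp: inner_add_left sum.distrib)
    then show "\<exists>D. ((\<lambda>x. G x + H x) has_derivative D) (at x) \<and> (\<Sum>b\<in>Basis. D b \<bullet> b) = k x + l x"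
      by (intro exI[of _ "\<lambda>h. G' h + H' h"])
  qed
qed

lemma has_laplacian_on_cmult:
  assumes "has_laplacian_on u k S"
  shows "has_laplacian_on (\<lambda>x. c * u x) (\<lambda>x. c * k x) S"
proof -
  obtain G where G: "\<And>x. x \<in> S \<Longrightarrow> GDERIV u x :> G x \<and>
     (\<exists>G'. (G has_derivative G') (at x) \<and> (\<Sum>b\<in>Basis. G' b \<bullet> b) = k x)"
    using assms(1) unfolding has_laplacian_on_def by blast
  show ?thesis
    unfolding has_laplacian_on_def
  proof (rule exI, intro ballI conjI)
    fix x assume x: "x \<in> S"
    have "(u has_derivative (\<lambda>h. h \<bullet> G x)) (at x)"
      using G[OF x] by (simp add: gderiv_def)
    then have "((\<lambda>x. c * u x) has_derivative (\<lambda>h. c * (h \<bullet> G x))) (at x)"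
      by (rule has_derivative_mult_right)
    then show "GDERIV (\<lambda>x. c * u x) x :> c *\<^sub>R G x"
      by (simp add: gderiv_def)
    obtain G' where "(G has_derivative G') (at x)" "(\<Sum>b\<in>Basis. G' b \<bullet> b) = k x"
      using G[OF x] by blast
    then have "((\<lambda>x. c *\<^sub>R G x) has_derivative (\<lambda>h. c *\<^sub>R G' h)) (at x) \<and>
      (\<Sum>b\<in>Basis. (c *\<^sub>R G' b) \<bullet> b) = c * k x"
      by (auto intro: has_derivative_scaleR_right simp flip: sum_distrib_left)
    then show "\<exists>D. ((\<lambda>x. c *\<^sub>R G x) has_derivative D) (at x) \<and> (\<Sum>b\<in>Basis. D b \<bullet> b) = c * k x"
      by (intro exI[of _ "\<lambda>h. c *\<^sub>R G' h"])
  qed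
qed

lemma has_laplacian_on_const: "has_laplacian_on (\<lambda>x. c) (\<lambda>x. 0) S"
  unfolding has_laplacian_on_def gderiv_def by (intro exI[of _ "\<lambda>x. 0"]) (auto intro!: exI[of _ "\<lambda>x. 0"])

text \<open>Serves twice: as the strictly subharmonic perturbation in the maximum principle, and as
  the particular solution for a constant Laplacian in a disk.\<close>

lemma has_laplacian_on_sqdist:
  fixes z :: "'a::euclidean_space"
  shows "has_laplacian_on (\<lambda>x. (dist z x)\<^sup>2) (\<lambda>x. 2 * DIM('a)) S"
  unfolding has_laplacian_on_def
proof (rule exI, intro ballI conjI)
  fix x assume "x \<in> S"
  have "((\<lambda>x. (x - z) \<bullet> (x - z)) has_derivative (\<lambda>h. h \<bullet> (2 *\<^sub>R (x - z)))) (at x)"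
    by (auto intro!: derivative_eq_intros simp: inner_commute)
  moreover have "(\<lambda>x. (dist z x)\<^sup>2) = (\<lambda>x. (x - z) \<bullet> (x - z))"
    by (simp add: dist_norm norm_minus_commute power2_norm_eq_inner)
  ultimately show "GDERIV (\<lambda>x. (dist z x)\<^sup>2) x :> 2 *\<^sub>R (x - z)"
    by (simp add: gderiv_def)
  have "((\<lambda>x. 2 *\<^sub>R (x - z)) has_derivative (\<lambda>h. 2 *\<^sub>R h)) (at x)"
    by (auto intro!: derivative_eq_intros)
  moreover have "(\<Sum>b\<in>(Basis::'a set). (2 *\<^sub>R b) \<bullet> b) = 2 * DIM('a)"
    by simp
  ultimately show "\<exists>D. ((\<lambda>x. 2 *\<^sub>R (x - z)) has_derivative D) (at x) \<and> (\<Sum>b\<in>Basis. D b \<bullet> b) = 2 * DIM('a)"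
    by (intro exI[of _ "\<lambda>h. 2 *\<^sub>R h"]) simp
qed

text \<open>Up to a factor this is the fundamental solution of the planar Laplacian. Dimension two
  enters through the trace: the identity part contributes \<open>2 / N\<close>, and the rank-one
  part removes exactly that.\<close>

lemma has_laplacian_on_ln_dist:
  fixes z :: "real^2"
  assumes "z \<notin> S"
  shows "has_laplacian_on (\<lambda>x. ln (dist z x)) (\<lambda>x. 0) S"
  unfolding has_laplacian_on_def
proof (rule exI, intro ballI conjI)
  fix x assume "x \<in> S"
  then have nz: "x - z \<noteq> 0" using assms by auto
  define N where "N = (x - z) \<bullet> (x - z)"
  have N: "N > 0" "N = (norm (x - z))\<^sup>2" using nz by (auto simp: N_def power2_norm_eq_inner)
  \<comment> \<open>The inner product is smooth everywhere, unlike the distance. As an equation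
    between functions this must also hold at \<open>x = z\<close>, where it rests on the convention
    \<open>ln 0 = 0\<close>.\<close>
  have eq: "(\<lambda>x. ln (dist z x)) = (\<lambda>x. ln ((x - z) \<bullet> (x - z)) / 2)"
  proof
    show "ln (dist z x) = ln ((x - z) \<bullet> (x - z)) / 2" for x
      by (cases "x = z") (auto simp: dist_norm norm_minus_commute ln_realpow simp flip: power2_norm_eq_inner)
  qed
  have sq: "((\<lambda>x. (x - z) \<bullet> (x - z)) has_derivative (\<lambda>h. 2 * ((x - z) \<bullet> h))) (at x)"
    by (auto intro!: derivative_eq_intros simp: inner_commute)
  have "(ln has_real_derivative inverse N) (at N)"
    using N(1) by (rule DERIV_ln)
  from DERIV_compose_FDERIV[OF this[unfolded N_def] sq]
  have "((\<lambda>x. ln ((x - z) \<bullet> (x - z)) * (1 / 2)) has_derivative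
      (\<lambda>h. 2 * ((x - z) \<bullet> h) * inverse N * (1 / 2))) (at x)"
    unfolding N_def by (rule has_derivative_mult_left)
  then have "((\<lambda>x. ln ((x - z) \<bullet> (x - z)) / 2) has_derivative (\<lambda>h. h \<bullet> ((1 / N) *\<^sub>R (x - z)))) (at x)"
    by (simp add: inner_commute inverse_eq_divide mult.commute)
  then show "GDERIV (\<lambda>x. ln (dist z x)) x :> (1 / ((x - z) \<bullet> (x - z))) *\<^sub>R (x - z)"
    unfolding gderiv_def eq N_def .
  have "(inverse has_real_derivative - (inverse N ^ Suc (Suc 0))) (at N)"
    using N(1) by (intro DERIV_inverse) auto
  from DERIV_compose_FDERIV[OF this[unfolded N_def] sq]
  have inv: "((\<lambda>x. inverse ((x - z) \<bullet> (x - z))) has_derivative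
      (\<lambda>h. 2 * ((x - z) \<bullet> h) * - (inverse N ^ Suc (Suc 0)))) (at x)"
    unfolding N_def .
  have id: "((\<lambda>x. x - z) has_derivative (\<lambda>h. h)) (at x)"
    by (auto intro!: derivative_eq_intros)
  have "((\<lambda>x. inverse ((x - z) \<bullet> (x - z)) *\<^sub>R (x - z)) has_derivative
      (\<lambda>h. inverse N *\<^sub>R h + (2 * ((x - z) \<bullet> h) * - (inverse N ^ Suc (Suc 0))) *\<^sub>R (x - z))) (at x)"
    using has_derivative_scaleR[OF inv id] unfolding N_def .
  then have "((\<lambda>x. (1 / ((x - z) \<bullet> (x - z))) *\<^sub>R (x - z)) has_derivative
     (\<lambda>h. (1 / N) *\<^sub>R h - (2 * ((x - z) \<bullet> h) / N\<^sup>2) *\<^sub>R (x - z))) (at x)"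
    by (simp add: inverse_eq_divide power2_eq_square)
  moreover have "(\<Sum>b\<in>Basis. ((1 / N) *\<^sub>R b - (2 * ((x - z) \<bullet> b) / N\<^sup>2) *\<^sub>R (x - z)) \<bullet> b) = 0"
  proof -
    have "(\<Sum>b\<in>Basis. ((1 / N) *\<^sub>R b - (2 * ((x - z) \<bullet> b) / N\<^sup>2) *\<^sub>R (x - z)) \<bullet> b)
      = (\<Sum>b\<in>(Basis::(real^2) set). 1 / N) - (2 / N\<^sup>2) * (\<Sum>b\<in>Basis. ((x - z) \<bullet> b) * ((x - z) \<bullet> b))"
      unfolding sum_distrib_left sum_subtractf[symmetric]
      by (intro sum.cong) (auto simp: inner_diff_left mult.assoc)
    also have "\<dots> = 2 / N - (2 / N\<^sup>2) * N"
      unfolding N_def euclidean_inner[symmetric] by simp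
    finally show ?thesis using N(1) by (simp add: power2_eq_square)
  qed
  ultimately show "\<exists>D. ((\<lambda>x. (1 / ((x - z) \<bullet> (x - z))) *\<^sub>R (x - z)) has_derivative D) (at x) \<and>
      (\<Sum>b\<in>Basis. D b \<bullet> b) = 0"
    by blast
qed

text \<open>If \<open>D > 0\<close>, then \<open>g'\<close> increases through its zero at 0 and is
  positive just to the right, so the mean value theorem gives a value above \<open>g 0\<close>. This
  asks for differentiability of \<open>g'\<close> at the single point 0.\<close>

lemma second_derivative_local_max:
  fixes g :: "real \<Rightarrow> real"
  assumes "d > 0" and g: "\<And>t. \<bar>t\<bar> < d \<Longrightarrow> (g has_real_derivative g' t) (at t)"
    and g': "(g' has_real_derivative D) (at 0)" and max: "\<And>t. \<bar>t\<bar> < d \<Longrightarrow> g t \<le> g 0"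
  shows "D \<le> 0"
proof (rule ccontr)
  assume "\<not> D \<le> 0"
  then obtain e where e: "e > 0" "\<And>h. 0 < h \<Longrightarrow> h < e \<Longrightarrow> g' 0 < g' (0 + h)"
    using DERIV_pos_inc_right[OF g'] by auto
  have g0: "g' 0 = 0"
    using DERIV_local_max[OF g[of 0] \<open>d > 0\<close>] max assms(1) by auto
  define t where "t = min d e / 2"
  have t: "0 < t" "t < d" "t < e" using e assms(1) by (auto simp: t_def min_def)
  obtain s where "0 < s" "s < t" "g t - g 0 = (t - 0) * g' s"
    using MVT2[of 0 t g g'] t g by auto
  moreover have "g' s > 0" using e(2)[of s] g0 calculation t by simp
  ultimately have "g t > g 0" using t by (simp add: algebra_simps)
  then show False using max[of t] t by simp
qed

text \<open>Restricting to each coordinate line through the maximum makes every diagonal entry of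
  the second derivative nonpositive, and the Laplacian is their sum.\<close>

lemma laplacian_nonpos_at_max:
  fixes u :: "'a::euclidean_space \<Rightarrow> real"
  assumes "open S" "has_laplacian_on u l S" "x \<in> S" "\<And>y. y \<in> S \<Longrightarrow> u y \<le> u x"
  shows "l x \<le> 0"
proof -
  obtain G where G: "\<And>x. x \<in> S \<Longrightarrow> GDERIV u x :> G x"
    and G1: "\<And>x. x \<in> S \<Longrightarrow> (\<exists>G'. (G has_derivative G') (at x) \<and> (\<Sum>b\<in>Basis. G' b \<bullet> b) = l x)"
    using assms(2) unfolding has_laplacian_on_def by blast
  obtain G' where G': "(G has_derivative G') (at x)" "(\<Sum>b\<in>Basis. G' b \<bullet> b) = l x"
    using G1 assms(3) by blast
  obtain d where d: "d > 0" "ball x d \<subseteq> S"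
    using assms(1,3) openE by blast
  have "G' b \<bullet> b \<le> 0" if b: "b \<in> Basis" for b
  proof (rule second_derivative_local_max[of d "\<lambda>t. u (x + t *\<^sub>R b)" "\<lambda>t. G (x + t *\<^sub>R b) \<bullet> b"])
    fix t :: real assume "\<bar>t\<bar> < d"
    then have mem: "x + t *\<^sub>R b \<in> S" using d(2) b by (auto simp: dist_norm)
    then show "u (x + t *\<^sub>R b) \<le> u (x + 0 *\<^sub>R b)" using assms(4) by simp
    have "(u has_derivative (\<lambda>h. h \<bullet> G (x + t *\<^sub>R b))) (at (x + t *\<^sub>R b))"
      using G[OF mem] by (simp add: gderiv_def)
    moreover have "((\<lambda>t. x + t *\<^sub>R b) has_derivative (\<lambda>h. h *\<^sub>R b)) (at t)"
      by (auto intro!: derivative_eq_intros)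
    ultimately have "((\<lambda>t. u (x + t *\<^sub>R b)) has_derivative (\<lambda>h. (h *\<^sub>R b) \<bullet> G (x + t *\<^sub>R b))) (at t)"
      using has_derivative_compose by fastforce
    then show "((\<lambda>t. u (x + t *\<^sub>R b)) has_real_derivative G (x + t *\<^sub>R b) \<bullet> b) (at t)"
      unfolding has_field_derivative_def
      by (rule has_derivative_eq_rhs) (auto simp: inner_commute)
  next
    have "((\<lambda>t. x + t *\<^sub>R b) has_derivative (\<lambda>h. h *\<^sub>R b)) (at (0::real))"
      by (auto intro!: derivative_eq_intros)
    moreover have "(G has_derivative G') (at (x + 0 *\<^sub>R b))" using G' by simp
    ultimately have "((\<lambda>t. G (x + t *\<^sub>R b)) has_derivative (\<lambda>h. G' (h *\<^sub>R b))) (at 0)"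
      by (rule has_derivative_compose)
    then have "((\<lambda>t. G (x + t *\<^sub>R b) \<bullet> b) has_derivative (\<lambda>h. G' (h *\<^sub>R b) \<bullet> b)) (at 0)"
      by (rule has_derivative_inner_left)
    moreover have "G' (h *\<^sub>R b) \<bullet> b = (G' b \<bullet> b) * h" for h
      using linear_cmul[OF has_derivative_linear[OF G'(1)]] by simp
    ultimately show "((\<lambda>t. G (x + t *\<^sub>R b) \<bullet> b) has_real_derivative G' b \<bullet> b) (at 0)"
      unfolding has_field_derivative_def by (simp add: fun_eq_iff[symmetric])
  qed (use d in auto)
  then have "(\<Sum>b\<in>Basis. G' b \<bullet> b) \<le> 0" by (rule sum_nonpos)
  then show ?thesis using G'(2) by simp
qed

text \<open>A zero Laplacian does not contradict an interior maximum, so \<open>u\<close> is first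
  made strictly subharmonic by a small multiple of the squared distance. The maximum of the
  perturbed function lies on the frontier, and the perturbation is then sent to 0.\<close>

lemma maximum_principle:
  fixes u :: "'a::euclidean_space \<Rightarrow> real"
  assumes S: "open S" "bounded S" and u: "has_laplacian_on u (\<lambda>x. 0) S" "continuous_on (closure S) u"
    and bd: "\<And>x. x \<in> frontier S \<Longrightarrow> u x \<le> 0" and x: "x \<in> closure S"
  shows "u x \<le> 0"
proof -
  obtain B where B: "B > 0" "\<And>y. y \<in> closure S \<Longrightarrow> (dist 0 y)\<^sup>2 \<le> B"
  proof -
    obtain b where "b > 0" "\<And>y. y \<in> closure S \<Longrightarrow> norm y \<le> b"
      using bounded_closure[OF S(2)] bounded_pos by blast
    then show ?thesis using that[of "b\<^sup>2"] by (auto intro: power_mono)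
  qed
  have "u x \<le> e * B" if "e > 0" for e
  proof -
    define v where "v y = u y + e * (dist 0 y)\<^sup>2" for y
    have lap: "has_laplacian_on v (\<lambda>y. 0 + e * (2 * DIM('a))) S"
      unfolding v_def by (intro has_laplacian_on_add u has_laplacian_on_cmult has_laplacian_on_sqdist)
    have "compact (closure S)" using S by (simp add: compact_closure)
    moreover have "continuous_on (closure S) v"
      unfolding v_def by (intro continuous_intros u)
    moreover have "closure S \<noteq> {}" using x by (metis empty_iff)
    ultimately have "\<exists>y\<in>closure S. \<forall>w\<in>closure S. v w \<le> v y"
      by (intro continuous_attains_sup)
    then obtain y where y: "y \<in> closure S" "\<And>w. w \<in> closure S \<Longrightarrow> v w \<le> v y" by blast
    have "y \<notin> S"
    proof
      assume "y \<in> S"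
      then have "0 + e * (2 * DIM('a)) \<le> 0"
        using y(2) closure_subset[of S] by (intro laplacian_nonpos_at_max[OF S(1) lap]) auto
      then show False using that DIM_positive[where 'a='a] by (simp add: mult_le_0_iff)
    qed
    then have "u y \<le> 0" using bd y(1) S(1) by (simp add: frontier_def interior_open)
    moreover have "e * (dist 0 y)\<^sup>2 \<le> e * B" using B(2)[OF y(1)] that by (intro mult_left_mono) auto
    ultimately have "v y \<le> e * B" by (simp add: v_def)
    moreover have "u x \<le> v x" using that by (simp add: v_def)
    ultimately show ?thesis using y(2)[OF x] by linarith
  qed
  from this[of "e / B" for e] have "u x \<le> 0 + e" if "e > 0" for e
    using that B(1) by simp
  then show ?thesis by (rule field_le_epsilon)
qed

section \<open>Differentiating the boundary condition\<close>

text \<open>The datum is only differentiable off the boundary \<open>e = 0\<close>, so the mean value theorem is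
  applied on parallel curves \<open>e > 0\<close>.\<close>

lemma tangential_derivative_nonpos:
  fixes \<Phi> \<Psi> :: "real \<Rightarrow> real \<Rightarrow> real"
  assumes "d > 0"
    and deriv: "\<And>s e. \<bar>s - s0\<bar> < d \<Longrightarrow> 0 < e \<Longrightarrow> e < d \<Longrightarrow> ((\<lambda>s. \<Phi> s e) has_real_derivative \<Psi> s e) (at s)"
    and lim: "\<And>s. \<bar>s - s0\<bar> < d \<Longrightarrow> (\<Phi> s \<longlongrightarrow> 0) (at_right 0)"
    and cont: "continuous_on ({s0-d<..<s0+d} \<times> {0..<d}) (\<lambda>(s, e). \<Psi> s e)"
  shows "\<Psi> s0 0 \<le> 0"
proof (rule ccontr)
  assume "\<not> \<Psi> s0 0 \<le> 0"
  then have pos: "\<Psi> s0 0 > 0" by simp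
  have "(s0, 0) \<in> {s0-d<..<s0+d} \<times> {0..<d}" "\<Psi> s0 0 / 2 > 0" using pos \<open>d > 0\<close> by auto
  with cont have "\<exists>k>0. \<forall>x\<in>{s0-d<..<s0+d} \<times> {0..<d}. dist x (s0, 0) < k \<longrightarrow>
      dist (case x of (s, e) \<Rightarrow> \<Psi> s e) (case (s0, 0) of (s, e) \<Rightarrow> \<Psi> s e) < \<Psi> s0 0 / 2"
    unfolding continuous_on_iff by blast
  then obtain k where k: "k > 0" "\<And>s e. \<bar>s - s0\<bar> < d \<Longrightarrow> 0 \<le> e \<Longrightarrow> e < d \<Longrightarrow> dist (s, e) (s0, 0) < k \<Longrightarrow>
      \<bar>\<Psi> s e - \<Psi> s0 0\<bar> < \<Psi> s0 0 / 2"
    by (force simp: dist_real_def abs_less_iff)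
  define h where "h = min d k / 2"
  have h: "0 < h" "h < d" "2 * h \<le> k" using k(1) \<open>d > 0\<close> by (auto simp: h_def min_def)
  have big: "\<Psi> s e > \<Psi> s0 0 / 2" if "\<bar>s - s0\<bar> < h" "0 < e" "e < h" for s e
  proof -
    have "dist (s, e) (s0, 0) \<le> \<bar>s - s0\<bar> + \<bar>e\<bar>"
      using real_sqrt_le_mono[of "(s - s0)\<^sup>2 + e\<^sup>2"] sqrt_sum_squares_le_sum_abs[of "s - s0" e]
      by (simp add: dist_Pair_Pair dist_real_def)
    then have "\<bar>\<Psi> s e - \<Psi> s0 0\<bar> < \<Psi> s0 0 / 2"
      using k(2)[of s e] that h by auto
    then show ?thesis by linarith
  qed
  let ?t = "s0 + h / 2"
  \<comment> \<open>The lower bound on the increment is the same for every small \<open>e\<close>,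
    so it survives the limit \<open>e \<rightarrow> 0\<close>, in which both values of
    \<open>\<Phi>\<close> vanish.\<close>
  have step: "\<Phi> ?t e - \<Phi> s0 e \<ge> h / 2 * (\<Psi> s0 0 / 2)" if e: "0 < e" "e < h" for e
  proof -
    obtain s where s: "s0 < s" "s < ?t" "\<Phi> ?t e - \<Phi> s0 e = (?t - s0) * \<Psi> s e"
      using MVT2[of s0 ?t "\<lambda>s. \<Phi> s e" "\<lambda>s. \<Psi> s e"] deriv[of _ e] h e by force
    have "h / 2 * (\<Psi> s0 0 / 2) \<le> h / 2 * \<Psi> s e"
      using big[of s e] s e h by (intro mult_left_mono) auto
    then show ?thesis using s(3) by simp
  qed
  have "((\<lambda>e. \<Phi> ?t e - \<Phi> s0 e) \<longlongrightarrow> 0 - 0) (at_right 0)"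
    using h \<open>d > 0\<close> by (intro tendsto_diff lim) auto
  moreover have "eventually (\<lambda>e. h / 2 * (\<Psi> s0 0 / 2) \<le> \<Phi> ?t e - \<Phi> s0 e) (at_right 0)"
    unfolding eventually_at_right[OF zero_less_one] using h(1) step by (intro exI[of _ h]) auto
  ultimately have "h / 2 * (\<Psi> s0 0 / 2) \<le> 0 - 0"
    using tendsto_lowerbound by (metis trivial_limit_at_right_real)
  then show False using h pos by (simp add: mult_le_0_iff)
qed

lemma tangential_derivative_zero:
  fixes \<Phi> \<Psi> :: "real \<Rightarrow> real \<Rightarrow> real"
  assumes "d > 0"
    and deriv: "\<And>s e. \<bar>s - s0\<bar> < d \<Longrightarrow> 0 < e \<Longrightarrow> e < d \<Longrightarrow> ((\<lambda>s. \<Phi> s e) has_real_derivative \<Psi> s e) (at s)"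
    and lim: "\<And>s. \<bar>s - s0\<bar> < d \<Longrightarrow> (\<Phi> s \<longlongrightarrow> 0) (at_right 0)"
    and cont: "continuous_on ({s0-d<..<s0+d} \<times> {0..<d}) (\<lambda>(s, e). \<Psi> s e)"
  shows "\<Psi> s0 0 = 0"
proof -
  have "- \<Psi> s0 0 \<le> 0"
  proof (rule tangential_derivative_nonpos[of d s0 "\<lambda>s e. - \<Phi> s e" "\<lambda>s e. - \<Psi> s e"])
    show "continuous_on ({s0-d<..<s0+d} \<times> {0..<d}) (\<lambda>(s, e). - \<Psi> s e)"
      using continuous_on_minus[OF cont] by (simp add: case_prod_unfold)
    show "((\<lambda>e. - \<Phi> s e) \<longlongrightarrow> 0) (at_right 0)" if "\<bar>s - s0\<bar> < d" for s
      using tendsto_minus[OF lim[OF that]] by simp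
  qed (use assms in \<open>auto intro: DERIV_minus\<close>)
  moreover have "\<Psi> s0 0 \<le> 0"
    by (rule tangential_derivative_nonpos[OF assms])
  ultimately show ?thesis by simp
qed

text \<open>The curve displaced by \<open>e *\<^sub>R w\<close> runs inside \<open>S\<close>, where
  the chain rule is available; letting \<open>e\<close> tend to 0 carries the identities to the
  extensions \<open>G\<close> and \<open>H\<close>. They are the first and second derivatives of
  \<open>u (c s) = 0\<close>, and the term with \<open>c2\<close> is what later brings in the
  curvature.\<close>

lemma boundary_tangential_derivatives:
  fixes u :: "real^2 \<Rightarrow> real" and c c1 c2 :: "real \<Rightarrow> real^2"
  assumes "d > 0"
    and c: "\<And>s. \<bar>s - s0\<bar> < d \<Longrightarrow> (c has_vector_derivative c1 s) (at s)"
    and c1: "\<And>s. \<bar>s - s0\<bar> < d \<Longrightarrow> (c1 has_vector_derivative c2 s) (at s)"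
    and c2: "continuous_on {s0-d<..<s0+d} c2"
    and S: "\<And>s e. \<bar>s - s0\<bar> < d \<Longrightarrow> 0 < e \<Longrightarrow> e < d \<Longrightarrow> c s + e *\<^sub>R w \<in> S"
    and u: "continuous_on (closure S) u" and u0: "\<And>s. \<bar>s - s0\<bar> < d \<Longrightarrow> u (c s) = 0"
    and G: "continuous_on (closure S) G" "\<And>x. x \<in> S \<Longrightarrow> GDERIV u x :> G x"
    and H: "continuous_on (closure S) H" "\<And>x. x \<in> S \<Longrightarrow> (G has_derivative (\<lambda>h. H x *v h)) (at x)"
  shows "G (c s0) \<bullet> c1 s0 = 0" "c1 s0 \<bullet> (H (c s0) *v c1 s0) + G (c s0) \<bullet> c2 s0 = 0"
proof -
  have lim0: "((\<lambda>e. c s + e *\<^sub>R w) \<longlongrightarrow> c s) (at_right 0)" for s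
    by (rule tendsto_eq_intros refl | simp)+
  have ev: "eventually (\<lambda>e. c s + e *\<^sub>R w \<in> S) (at_right 0)" if "\<bar>s - s0\<bar> < d" for s
    using S that \<open>d > 0\<close> by (auto simp: eventually_at_right intro!: exI[of _ d])
  have cl0: "c s \<in> closure S" if "\<bar>s - s0\<bar> < d" for s
  proof (rule Lim_in_closed_set[OF closed_closure _ _ lim0])
    show "eventually (\<lambda>e. c s + e *\<^sub>R w \<in> closure S) (at_right 0)"
      using ev[OF that] by (rule eventually_mono) (use closure_subset in blast)
  qed simp
  have cl: "c s + e *\<^sub>R w \<in> closure S" if "\<bar>s - s0\<bar> < d" "0 \<le> e" "e < d" for s e
    using cl0[OF that(1)] S[OF that(1), of e] that closure_subset by (cases "e = 0") auto
  let ?I = "{s0-d<..<s0+d}"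
  have I: "s \<in> ?I \<longleftrightarrow> \<bar>s - s0\<bar> < d" for s by auto
  have cc: "continuous_on ?I c"
    by (intro continuous_at_imp_continuous_on ballI has_vector_derivative_continuous[OF c]) auto
  have cc1: "continuous_on ?I c1"
    by (intro continuous_at_imp_continuous_on ballI has_vector_derivative_continuous[OF c1]) auto
  let ?X = "?I \<times> {0..<d}"
  have arg: "continuous_on ?X (\<lambda>x. c (fst x) + snd x *\<^sub>R w)"
    by (intro continuous_intros continuous_on_compose2[OF cc]) auto
  have arg_cl: "(\<lambda>x. c (fst x) + snd x *\<^sub>R w) ` ?X \<subseteq> closure S"
    using cl by (auto simp: I)
  have GX: "continuous_on ?X (\<lambda>x. G (c (fst x) + snd x *\<^sub>R w))"
    by (rule continuous_on_compose2[OF G(1) arg arg_cl])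
  have HX: "continuous_on ?X (\<lambda>x. H (c (fst x) + snd x *\<^sub>R w))"
    by (rule continuous_on_compose2[OF H(1) arg arg_cl])
  have c1X: "continuous_on ?X (\<lambda>x. c1 (fst x))"
    by (intro continuous_intros continuous_on_compose2[OF cc1]) auto
  have c2X: "continuous_on ?X (\<lambda>x. c2 (fst x))"
    by (intro continuous_intros continuous_on_compose2[OF c2]) auto
  have filt: "filterlim (\<lambda>e. c s + e *\<^sub>R w) (at (c s) within closure S) (at_right 0)" 
    if "\<bar>s - s0\<bar> < d" "w \<noteq> 0" for s
    unfolding filterlim_at
    using lim0[of s] ev[OF that(1)] closure_subset[of S] that(2)
    by (auto elim!: eventually_mono[OF eventually_conj[OF _ eventually_at_right_less[of 0]]])
  have limG: "((\<lambda>e. f (c s + e *\<^sub>R w)) \<longlongrightarrow> f (c s)) (at_right 0)"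
    if "continuous_on (closure S) f" "\<bar>s - s0\<bar> < d" for s and f :: "real^2 \<Rightarrow> 'c::topological_space"
  proof (cases "w = 0")
    case False
    have "(f \<longlongrightarrow> f (c s)) (at (c s) within closure S)"
      using that(1) cl0[OF that(2)] by (simp add: continuous_on_def)
    then show ?thesis using filt[OF that(2) False] by (rule filterlim_compose)
  qed simp
  have shift: "((\<lambda>s. c s + e *\<^sub>R w) has_derivative (\<lambda>h. h *\<^sub>R c1 s)) (at s)" if "\<bar>s - s0\<bar> < d" for s e
    using c[OF that] unfolding has_vector_derivative_def
    by (auto intro!: derivative_eq_intros)
  \<comment> \<open>Needed at every parameter, not only at \<open>s0\<close>: this identity is the
    vanishing boundary datum when the argument is repeated with \<open>G \<bullet> c1\<close> in
    place of \<open>u\<close>.\<close>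
  have G0: "G (c s) \<bullet> c1 s = 0" if s: "\<bar>s - s0\<bar> < d" for s
  proof -
    define k where "k = d - \<bar>s - s0\<bar>"
    have k: "k > 0" "k \<le> d" "\<And>t. \<bar>t - s\<bar> < k \<Longrightarrow> \<bar>t - s0\<bar> < d" using s by (auto simp: k_def)
    have "G (c s + 0 *\<^sub>R w) \<bullet> c1 s = 0"
    proof (rule tangential_derivative_zero[of k s "\<lambda>s e. u (c s + e *\<^sub>R w)" "\<lambda>s e. G (c s + e *\<^sub>R w) \<bullet> c1 s"])
      fix t e :: real assume t: "\<bar>t - s\<bar> < k" "0 < e" "e < k"
      have "(u has_derivative (\<lambda>h. h \<bullet> G (c t + e *\<^sub>R w))) (at (c t + e *\<^sub>R w))"
        using G(2) S k t by (simp add: gderiv_def)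
      from has_derivative_compose[OF shift[OF k(3)[OF t(1)]] this]
      show "((\<lambda>s. u (c s + e *\<^sub>R w)) has_real_derivative G (c t + e *\<^sub>R w) \<bullet> c1 t) (at t)"
        unfolding has_field_derivative_def
        by (rule has_derivative_eq_rhs) (auto simp: inner_commute)
    next
      show "((\<lambda>e. u (c t + e *\<^sub>R w)) \<longlongrightarrow> 0) (at_right 0)" if "\<bar>t - s\<bar> < k" for t
        using limG[OF u k(3)[OF that]] u0[OF k(3)[OF that]] by simp
      have "continuous_on ?X (\<lambda>x. G (c (fst x) + snd x *\<^sub>R w) \<bullet> c1 (fst x))"
        by (intro continuous_intros GX c1X)
      then show "continuous_on ({s-k<..<s+k} \<times> {0..<k}) (\<lambda>(s, e). G (c s + e *\<^sub>R w) \<bullet> c1 s)"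
        unfolding case_prod_unfold by (rule continuous_on_subset) (auto simp: k_def abs_if split: if_splits)
    qed (use k in auto)
    then show ?thesis by simp
  qed
  show "G (c s0) \<bullet> c1 s0 = 0" using G0[of s0] \<open>d > 0\<close> by simp
  have "(H (c s0 + 0 *\<^sub>R w) *v c1 s0) \<bullet> c1 s0 + G (c s0 + 0 *\<^sub>R w) \<bullet> c2 s0 = 0"
  proof (rule tangential_derivative_zero[of d s0 "\<lambda>s e. G (c s + e *\<^sub>R w) \<bullet> c1 s" 
        "\<lambda>s e. (H (c s + e *\<^sub>R w) *v c1 s) \<bullet> c1 s + G (c s + e *\<^sub>R w) \<bullet> c2 s"])
    fix s e :: real assume s: "\<bar>s - s0\<bar> < d" "0 < e" "e < d"
    have "(c1 has_derivative (\<lambda>h. h *\<^sub>R c2 s)) (at s)"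
      using c1[OF s(1)] by (simp add: has_vector_derivative_def)
    from has_derivative_inner[OF has_derivative_compose[OF shift[OF s(1)] H(2)[OF S[OF s]]] this]
    show "((\<lambda>s. G (c s + e *\<^sub>R w) \<bullet> c1 s) has_real_derivative 
        (H (c s + e *\<^sub>R w) *v c1 s) \<bullet> c1 s + G (c s + e *\<^sub>R w) \<bullet> c2 s) (at s)"
      unfolding has_field_derivative_def
      by (rule has_derivative_eq_rhs) (auto simp: fun_eq_iff algebra_simps matrix_vector_mult_scaleR)
  next
    show "((\<lambda>e. G (c s + e *\<^sub>R w) \<bullet> c1 s) \<longlongrightarrow> 0) (at_right 0)" if "\<bar>s - s0\<bar> < d" for s
      using tendsto_inner[OF limG[OF G(1) that] tendsto_const[of "c1 s"]] G0[OF that] by simp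
    show "continuous_on ?X (\<lambda>(s, e). (H (c s + e *\<^sub>R w) *v c1 s) \<bullet> c1 s + G (c s + e *\<^sub>R w) \<bullet> c2 s)"
      unfolding case_prod_unfold matrix_vector_mult_def
      by (intro continuous_intros GX HX c1X c2X continuous_on_vec_lambda)
  qed (use \<open>d > 0\<close> in auto)
  then show "c1 s0 \<bullet> (H (c s0) *v c1 s0) + G (c s0) \<bullet> c2 s0 = 0" by (simp add: inner_commute)
qed


section \<open>Orthonormal frames of the plane\<close>

text \<open>\<open>D\<close> is the determinant of the pair, hence 1 or -1, and \<open>b\<close> is
  \<open>a\<close> turned by a quarter in one of the two directions. Eliminating \<open>b\<close>
  turns identities for frames into polynomial consequences of \<open>D * D = 1\<close> and
  \<open>norm a = 1\<close>.\<close>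

lemma orthonormal_2_rotation:
  fixes a b :: "real^2"
  assumes "norm a = 1" "norm b = 1" "a \<bullet> b = 0"
  obtains D where "D * D = 1" "b $ 1 = - D * a $ 2" "b $ 2 = D * a $ 1"
    "a $ 1 * a $ 1 + a $ 2 * a $ 2 = 1"
proof
  let ?D = "a $ 1 * b $ 2 - a $ 2 * b $ 1"
  have a: "a $ 1 * a $ 1 + a $ 2 * a $ 2 = 1" and b: "b $ 1 * b $ 1 + b $ 2 * b $ 2 = 1"
    and ab: "a $ 1 * b $ 1 + a $ 2 * b $ 2 = 0"
    using assms by (simp_all add: norm_eq_1 inner_vec_def sum_2)
  show "?D * ?D = 1" "b $ 1 = - ?D * a $ 2" "b $ 2 = ?D * a $ 1" 
    "a $ 1 * a $ 1 + a $ 2 * a $ 2 = 1"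
    using a b ab by algebra+
qed

lemma orthonormal_2_expansion:
  fixes a b v :: "real^2"
  assumes "norm a = 1" "norm b = 1" "a \<bullet> b = 0"
  shows "v = (v \<bullet> a) *\<^sub>R a + (v \<bullet> b) *\<^sub>R b"
proof -
  obtain D where D: "D * D = 1" "b $ 1 = - D * a $ 2" "b $ 2 = D * a $ 1"
    "a $ 1 * a $ 1 + a $ 2 * a $ 2 = 1"
    using orthonormal_2_rotation[OF assms] .
  show ?thesis
    using D(1,4) by (simp add: vec_eq_iff forall_2 inner_vec_def sum_2 D(2,3)) algebra
qed

text \<open>Invariance of the trace under a change of frame; it splits the Laplacian at a boundary
  point into a tangential and a normal second derivative.\<close>

lemma trace_orthonormal_2:
  fixes a b :: "real^2" and M :: "real^2^2"
  assumes "norm a = 1" "norm b = 1" "a \<bullet> b = 0"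
  shows "trace M = a \<bullet> (M *v a) + b \<bullet> (M *v b)"
proof -
  obtain D where D: "D * D = 1" "b $ 1 = - D * a $ 2" "b $ 2 = D * a $ 1"
    "a $ 1 * a $ 1 + a $ 2 * a $ 2 = 1"
    using orthonormal_2_rotation[OF assms] .
  show ?thesis
    using D(1,4)
    by (simp add: trace_def matrix_vector_mult_def inner_vec_def sum_2 D(2,3)) algebra
qed

section \<open>Functions of class \<open>C\<^sup>2\<close> up to the boundary\<close>

text \<open>Justifies the description in \<open>gradient\<close>: the vector with components
  \<open>f' b\<close> represents the derivative, and uniqueness of derivatives makes it the only
  candidate.\<close>

lemma GDERIV_gradient:
  fixes u :: "real^2 \<Rightarrow> real"
  assumes "u differentiable (at x)"
  shows "GDERIV u x :> gradient u x"
proof -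
  obtain f' where f': "(u has_derivative f') (at x)" using assms by (auto simp: differentiable_def)
  interpret bounded_linear f' using has_derivative_bounded_linear[OF f'] .
  let ?D = "\<Sum>b\<in>Basis. f' b *\<^sub>R b"
  have "f' = (\<lambda>h. h \<bullet> ?D)"
  proof
    fix h
    have "f' h = f' (\<Sum>b\<in>Basis. (h \<bullet> b) *\<^sub>R b)" by (simp add: euclidean_representation)
    also have "\<dots> = h \<bullet> ?D" by (simp add: sum scaleR inner_sum_right mult.commute)
    finally show "f' h = h \<bullet> ?D" .
  qed
  then have D: "GDERIV u x :> ?D" using f' by (simp add: gderiv_def)
  have "E = ?D" if "GDERIV u x :> E" for E
  proof -
    have "(\<lambda>h. h \<bullet> E) = (\<lambda>h. h \<bullet> ?D)"
      using that D unfolding gderiv_def by (rule has_derivative_unique)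
    then have "\<forall>h. h \<bullet> E = h \<bullet> ?D" by (intro allI) (rule fun_cong)
    then show ?thesis by (simp only: vector_eq_ldot)
  qed
  then have "gradient u x = ?D" unfolding gradient_def using D by (intro the_equality)
  then show ?thesis using D by simp
qed

lemma has_derivative_gradient:
  assumes "gradient u differentiable (at x)"
  shows "(gradient u has_derivative (\<lambda>h. hessian u x *v h)) (at x)"
  using assms unfolding hessian_def jacobian_works .

text \<open>From here on \<open>G\<close> and \<open>H\<close> stand in for
  \<open>gradient u\<close> and \<open>hessian u\<close>, whose own values on the boundary are not
  controlled. As \<open>S\<close> is open, \<open>G\<close> has the same derivative as the gradient
  it agrees with there.\<close>

lemma C2_up_to_boundary_extension:
  assumes "open S" "C2_up_to_boundary S u"
  obtains G H where "continuous_on (closure S) u" "continuous_on (closure S) G" "continuous_on (closure S) H"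
    "\<And>x. x \<in> S \<Longrightarrow> G x = gradient u x" "\<And>x. x \<in> S \<Longrightarrow> H x = hessian u x"
    "\<And>x. x \<in> S \<Longrightarrow> GDERIV u x :> G x" "\<And>x. x \<in> S \<Longrightarrow> (G has_derivative (\<lambda>h. H x *v h)) (at x)"
proof -
  obtain G H where G: "continuous_on (closure S) G" "\<And>x. x \<in> S \<Longrightarrow> G x = gradient u x"
    and H: "continuous_on (closure S) H" "\<And>x. x \<in> S \<Longrightarrow> H x = hessian u x"
    and u: "continuous_on (closure S) u"
    and d: "\<And>x. x \<in> S \<Longrightarrow> u differentiable (at x)" "\<And>x. x \<in> S \<Longrightarrow> gradient u differentiable (at x)"
    using assms(2) unfolding C2_up_to_boundary_def by blast
  show ?thesis
  proof (rule that[OF u G(1) H(1) G(2) H(2)])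
    fix x assume x: "x \<in> S"
    show "GDERIV u x :> G x" using GDERIV_gradient[OF d(1)[OF x]] G(2)[OF x] by simp
    have "(gradient u has_derivative (\<lambda>h. H x *v h)) (at x)"
      using has_derivative_gradient[OF d(2)[OF x]] H(2)[OF x] by simp
    then show "(G has_derivative (\<lambda>h. H x *v h)) (at x)"
      by (rule has_derivative_transform_within_open[OF _ assms(1) x]) (simp add: G(2))
  qed
qed

text \<open>A point of the closure outside \<open>S\<close> is a limit point of \<open>S\<close>, so
  the limit from \<open>S\<close> is unique and \<open>Lim\<close> returns it.\<close>

lemma boundary_value_eq:
  fixes f :: "real^2 \<Rightarrow> 'b::t2_space"
  assumes "continuous_on (closure S) F" "\<And>x. x \<in> S \<Longrightarrow> F x = f x" "p \<in> closure S" "p \<notin> S"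
  shows "boundary_value S f p = F p"
proof -
  have "(F \<longlongrightarrow> F p) (at p within S)"
    using assms(1,3) closure_subset by (meson continuous_on_def tendsto_within_subset)
  then have "(f \<longlongrightarrow> F p) (at p within S)"
    by (rule Lim_transform_eventually) (auto simp: eventually_at_filter assms(2))
  moreover have "\<not> trivial_limit (at p within S)"
    using assms(3,4) by (simp add: trivial_limit_within closure_def)
  ultimately show ?thesis unfolding boundary_value_def by (intro tendsto_Lim)
qed

lemma has_laplacian_on_laplacian:
  assumes "open S" "C2_up_to_boundary S u" "\<And>x. x \<in> S \<Longrightarrow> laplacian u x = l x"
  shows "has_laplacian_on u l S"
proof -
  obtain G H where GH: "\<And>x. x \<in> S \<Longrightarrow> H x = hessian u x"
    "\<And>x. x \<in> S \<Longrightarrow> GDERIV u x :> G x" "\<And>x. x \<in> S \<Longrightarrow> (G has_derivative (\<lambda>h. H x *v h)) (at x)"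
    using C2_up_to_boundary_extension[OF assms(1,2)] by metis
  have "(\<Sum>b\<in>Basis. (H x *v b) \<bullet> b) = l x" if "x \<in> S" for x
  proof -
    have "l x = trace (H x)" using assms(3)[OF that] GH(1)[OF that] by (simp add: laplacian_def)
    moreover have "(\<Sum>b\<in>Basis. (M *v b) \<bullet> b) = trace M" for M :: "real^2^2"
    proof -
      have B: "(Basis :: (real^2) set) = {axis 1 1, axis 2 1}"
        by (auto simp: Basis_vec_def UNIV_2)
      have "axis 1 1 \<noteq> (axis 2 1 :: real^2)" by (simp add: axis_eq_axis)
      then have "(\<Sum>b\<in>Basis. (M *v b) \<bullet> b) = (M *v axis 1 1) \<bullet> axis 1 1 + (M *v axis 2 1) \<bullet> axis 2 1"
        unfolding B by simp
      then show ?thesis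
        using trace_orthonormal_2[of "axis 1 1" "axis 2 1" M] by (simp add: inner_axis_axis inner_commute)
    qed
    ultimately show ?thesis by simp
  qed
  then show ?thesis unfolding has_laplacian_on_def using GH(2,3) by blast
qed

section \<open>Boundaries that are locally graphs\<close>

locale graph_chart =
  fixes \<Omega> :: "(real^2) set" and p0 \<tau> n :: "real^2" and r :: real and \<phi> \<phi>1 \<phi>2 :: "real \<Rightarrow> real"
  assumes frame: "norm \<tau> = 1" "norm n = 1" "\<tau> \<bullet> n = 0" and r_pos: "r > 0"
    and \<phi>: "\<And>s. \<bar>s\<bar> < r \<Longrightarrow> (\<phi> has_real_derivative \<phi>1 s) (at s)"
    and \<phi>1: "\<And>s. \<bar>s\<bar> < r \<Longrightarrow> (\<phi>1 has_real_derivative \<phi>2 s) (at s)"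
    and \<phi>2: "continuous_on {-r<..<r} \<phi>2"
    and subgraph: "\<And>x. x \<in> ball p0 r \<Longrightarrow> x \<in> \<Omega> \<longleftrightarrow> (x - p0) \<bullet> n < \<phi> ((x - p0) \<bullet> \<tau>)"
begin

definition pt :: "real \<Rightarrow> real^2" where "pt s = p0 + s *\<^sub>R \<tau> + \<phi> s *\<^sub>R n"
definition sx :: "real^2 \<Rightarrow> real" where "sx x = (x - p0) \<bullet> \<tau>"
definition ht :: "real^2 \<Rightarrow> real" where "ht x = (x - p0) \<bullet> n"
text \<open>The length of the tangent vector \<open>\<tau> + \<phi>1 s *\<^sub>R n\<close>, that is,
  the arc length density of the graph.\<close>

definition slope :: "real \<Rightarrow> real" where "slope s = sqrt (1 + (\<phi>1 s)\<^sup>2)"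
definition nu :: "real \<Rightarrow> real^2" where "nu s = (1 / slope s) *\<^sub>R (n - \<phi>1 s *\<^sub>R \<tau>)"
text \<open>The classical curvature of a graph. The minus sign matches the convention for disks: the
  set lies below the graph, so it is locally strictly convex where \<open>\<phi>2\<close> is
  negative.\<close>

definition curv :: "real \<Rightarrow> real" where "curv s = - \<phi>2 s / slope s ^ 3"

section \<open>Graph coordinates and the boundary as a graph\<close>

lemma inner_frame [simp]:
  "\<tau> \<bullet> \<tau> = 1" "n \<bullet> n = 1" "\<tau> \<bullet> n = 0" "n \<bullet> \<tau> = 0"
  using frame by (auto simp: norm_eq_1 inner_commute)

lemma slope: "slope s > 0" "slope s * slope s = 1 + (\<phi>1 s)\<^sup>2"
  by (auto simp: slope_def add_pos_nonneg)

lemma coords_shift [simp]: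
  "sx (x + a *\<^sub>R n) = sx x" "ht (x + a *\<^sub>R n) = ht x + a"
  "sx (pt s) = s" "ht (pt s) = \<phi> s"
  by (auto simp: pt_def sx_def ht_def algebra_simps)

lemma pt_coords: "x = p0 + sx x *\<^sub>R \<tau> + ht x *\<^sub>R n"
proof -
  have "x = p0 + (x - p0)" by simp
  also have "x - p0 = sx x *\<^sub>R \<tau> + ht x *\<^sub>R n"
    unfolding sx_def ht_def by (rule orthonormal_2_expansion[OF frame])
  finally show ?thesis by (simp only: add.assoc)
qed

lemma abs_sx: "x \<in> ball p0 r \<Longrightarrow> \<bar>sx x\<bar> < r"
  using Cauchy_Schwarz_ineq2[of "x - p0" \<tau>] frame by (simp add: sx_def dist_norm norm_minus_commute)

lemma frame_nu: "norm (nu s) = 1" "nu s \<bullet> (\<tau> + \<phi>1 s *\<^sub>R n) = 0"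
proof -
  have "nu s \<bullet> nu s = (1 + (\<phi>1 s)\<^sup>2) / (slope s * slope s)"
    by (simp add: nu_def algebra_simps power2_eq_square add_divide_distrib)
  then have "nu s \<bullet> nu s = 1" unfolding slope(2)[symmetric] using slope(1)[of s] by simp
  then show "norm (nu s) = 1" by (simp add: norm_eq_1)
  show "nu s \<bullet> (\<tau> + \<phi>1 s *\<^sub>R n) = 0" by (simp add: nu_def algebra_simps)
qed

lemma continuous_\<phi>: "continuous_on {-r<..<r} \<phi>"
  by (intro continuous_at_imp_continuous_on ballI DERIV_isCont[OF \<phi>]) auto

lemma continuous_\<phi>1: "continuous_on {-r<..<r} \<phi>1"
  by (intro continuous_at_imp_continuous_on ballI DERIV_isCont[OF \<phi>1]) auto

lemma continuous_height: "continuous_on (ball p0 r) (\<lambda>x. ht x - \<phi> (sx x))"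
proof -
  have "continuous_on (ball p0 r) (\<lambda>x. \<phi> (sx x))"
  proof (rule continuous_on_compose2[OF continuous_\<phi>])
    show "continuous_on (ball p0 r) sx" unfolding sx_def by (intro continuous_intros)
    show "sx ` ball p0 r \<subseteq> {-r<..<r}"
      using abs_sx by (auto simp: abs_less_iff minus_less_iff)
  qed
  then show ?thesis unfolding ht_def by (intro continuous_intros)
qed

lemma below: "x \<in> ball p0 r \<Longrightarrow> ht x < \<phi> (sx x) \<Longrightarrow> x \<in> interior \<Omega>"
proof (rule interiorI)
  show "open {x \<in> ball p0 r. ht x - \<phi> (sx x) < 0}"
    using continuous_on_open_vimage[of "ball p0 r" "\<lambda>x. ht x - \<phi> (sx x)"] continuous_height
    by (auto simp: vimage_def Int_def conj_commute dest: spec[of _ "{..<0}"])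
qed (use subgraph in \<open>auto simp: ht_def sx_def\<close>)

lemma above: "x \<in> ball p0 r \<Longrightarrow> \<phi> (sx x) < ht x \<Longrightarrow> x \<notin> closure \<Omega>"
proof -
  assume x: "x \<in> ball p0 r" "\<phi> (sx x) < ht x"
  have "open {x \<in> ball p0 r. ht x - \<phi> (sx x) > 0}" (is "open ?U")
    using continuous_on_open_vimage[of "ball p0 r" "\<lambda>x. ht x - \<phi> (sx x)"] continuous_height
    by (auto simp: vimage_def Int_def conj_commute dest: spec[of _ "{0<..}"])
  moreover have "?U \<inter> \<Omega> = {}" using subgraph by (force simp: ht_def sx_def)
  ultimately have "?U \<inter> closure \<Omega> = {}" by (simp add: open_Int_closure_eq_empty)
  then show ?thesis using x by auto
qed

text \<open>The chart inequality is strict, so points of the graph are outside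
  \<open>\<Omega>\<close>; they are limits of points moved down along \<open>n\<close>, which are
  interior. Strictly above and strictly below are open conditions, which settles all other
  points.\<close>

lemma graph_frontier:
  assumes x: "x \<in> ball p0 r"
  shows "x \<in> frontier \<Omega> \<longleftrightarrow> ht x = \<phi> (sx x)"
proof
  assume "x \<in> frontier \<Omega>"
  then show "ht x = \<phi> (sx x)" using above[OF x] below[OF x] by (force simp: frontier_def)
next
  assume eq: "ht x = \<phi> (sx x)"
  then have "x \<notin> interior \<Omega>" using subgraph[OF x] interior_subset[of \<Omega>] by (auto simp: ht_def sx_def)
  moreover have "x \<in> closure \<Omega>"
  proof (rule Lim_in_closed_set[OF closed_closure _ trivial_limit_at_right_real])
    show lim: "((\<lambda>e. x + (-e) *\<^sub>R n) \<longlongrightarrow> x) (at_right 0)" 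
      by (rule tendsto_eq_intros refl | simp)+
    have "eventually (\<lambda>e. x + (-e) *\<^sub>R n \<in> ball p0 r) (at_right 0)"
      using topological_tendstoD[OF lim open_ball x] .
    then show "eventually (\<lambda>e. x + (-e) *\<^sub>R n \<in> closure \<Omega>) (at_right 0)"
      using eventually_at_right_less[of 0]
    proof eventually_elim
      case (elim e)
      have "x + (-e) *\<^sub>R n \<in> interior \<Omega>"
        using elim eq coords_shift(1,2)[of x "-e"] by (intro below) (auto simp del: coords_shift)
      then show ?case using interior_subset closure_subset by blast
    qed
  qed
  ultimately show "x \<in> frontier \<Omega>" by (simp add: frontier_def)
qed

lemma graph_point:
  assumes "p \<in> frontier \<Omega>" "p \<in> ball p0 r"
  shows "p = pt (sx p)" "\<bar>sx p\<bar> < r"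
proof -
  have "\<phi> (sx p) = ht p" using assms graph_frontier[of p] by simp
  then show "p = pt (sx p)" unfolding pt_def by (simp only: pt_coords[symmetric])
  show "\<bar>sx p\<bar> < r" using assms(2) by (rule abs_sx)
qed

section \<open>Boundary curves, outward normal and curvature in a chart\<close>

lemma pt_deriv: "\<bar>s\<bar> < r \<Longrightarrow> (pt has_vector_derivative (\<tau> + \<phi>1 s *\<^sub>R n)) (at s)"
  using has_vector_derivative_add[OF has_vector_derivative_add[OF has_vector_derivative_const[of p0]
      has_vector_derivative_scaleR[OF DERIV_ident has_vector_derivative_const[of \<tau>]]]
      has_vector_derivative_scaleR[OF \<phi> has_vector_derivative_const[of n]]]
  by (simp add: pt_def[abs_def])

lemma pt_deriv2: "\<bar>s\<bar> < r \<Longrightarrow> ((\<lambda>s. \<tau> + \<phi>1 s *\<^sub>R n) has_vector_derivative \<phi>2 s *\<^sub>R n) (at s)"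
  using has_vector_derivative_add[OF has_vector_derivative_const[of \<tau>]
      has_vector_derivative_scaleR[OF \<phi>1 has_vector_derivative_const[of n]]]
  by simp

text \<open>Makes room for the vertical translates of the graph, the parallel curves along which
  boundary conditions are differentiated. Half of the distance to the edge of the ball is reserved
  for moving along the graph, half for the vertical shift.\<close>

lemma tube:
  assumes "\<bar>s0\<bar> < r" "pt s0 \<in> ball p0 r"
  obtains d where "d > 0" "\<And>s e. \<bar>s - s0\<bar> < d \<Longrightarrow> \<bar>e\<bar> < d \<Longrightarrow> \<bar>s\<bar> < r \<and> pt s + e *\<^sub>R n \<in> ball p0 r"
proof -
  define k where "k = r - dist p0 (pt s0)"
  have k: "k > 0" using assms by (simp add: k_def)
  have "isCont pt s0" using pt_deriv[OF assms(1)] has_vector_derivative_continuous by blast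
  then obtain d1 where d1: "d1 > 0" "\<And>s. \<bar>s - s0\<bar> < d1 \<Longrightarrow> dist (pt s) (pt s0) < k / 2"
    using k unfolding continuous_at_eps_delta dist_real_def by (metis half_gt_zero)
  define d where "d = min d1 (min (k / 2) (r - \<bar>s0\<bar>))"
  have d: "d > 0" "d \<le> d1" "d \<le> k / 2" "d \<le> r - \<bar>s0\<bar>" using d1(1) k assms unfolding d_def by linarith+
  show ?thesis
  proof (rule that[OF d(1)])
    fix s e assume s: "\<bar>s - s0\<bar> < d" "\<bar>e\<bar> < d"
    have "dist p0 (pt s + e *\<^sub>R n) \<le> dist p0 (pt s0) + dist (pt s) (pt s0) + \<bar>e\<bar>"
      using dist_triangle[of p0 "pt s + e *\<^sub>R n" "pt s"] dist_triangle[of p0 "pt s" "pt s0"] frame(2)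
      by (simp add: dist_commute dist_norm[of "pt s"])
    then have "pt s + e *\<^sub>R n \<in> ball p0 r" using d1(2)[of s] s d by (simp add: k_def)
    then show "\<bar>s\<bar> < r \<and> pt s + e *\<^sub>R n \<in> ball p0 r" using s d by auto
  qed
qed

text \<open>An admissible curve stays on the graph near 0, so
  \<open>ht (c t) = \<phi> (sx (c t))\<close> may be differentiated twice. The results express the
  normal data of any such curve through \<open>\<phi>\<close>, which yields independence of the
  curve.\<close>

lemma regular_boundary_curve_derivatives:
  assumes p: "p \<in> ball p0 r" and c: "regular_boundary_curve \<Omega> p c"
  defines "v \<equiv> vector_derivative c (at 0)"
    and "a \<equiv> vector_derivative (\<lambda>t. vector_derivative c (at t)) (at 0)"
  shows "v \<bullet> n = \<phi>1 (sx p) * (v \<bullet> \<tau>)" "v \<bullet> \<tau> \<noteq> 0"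
    "a \<bullet> n = \<phi>2 (sx p) * (v \<bullet> \<tau>)\<^sup>2 + \<phi>1 (sx p) * (a \<bullet> \<tau>)"
proof -
  have c0: "c 0 = p" and ev: "\<forall>\<^sub>F t in nhds 0. c t \<in> frontier \<Omega> \<and> c differentiable (at t)"
    and v0: "v \<noteq> 0" and a: "((\<lambda>t. vector_derivative c (at t)) has_vector_derivative a) (at 0)"
    using c vector_derivative_works unfolding regular_boundary_curve_def v_def a_def by auto
  define C where "C t = vector_derivative c (at t)" for t
  have Cd: "(c has_vector_derivative C t) (at t)" if "c differentiable (at t)" for t
    using that vector_derivative_works unfolding C_def by blast
  have "c differentiable (at 0)" using eventually_nhds_x_imp_x[OF ev] by blast
  then have "isCont c 0" using differentiable_imp_continuous_within by blast
  then have "\<forall>\<^sub>F t in nhds 0. c t \<in> ball p0 r"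
    using p c0 topological_tendstoD[of c p "nhds 0" "ball p0 r"]
      tendsto_at_iff_tendsto_nhds[of c 0] by (simp add: isCont_def)
  with ev have ev1: "\<forall>\<^sub>F t in nhds 0. c t \<in> ball p0 r \<and> c differentiable (at t) \<and> ht (c t) = \<phi> (sx (c t))"
  proof eventually_elim
    case (elim t)
    then show ?case using graph_frontier[of "c t"] by blast
  qed
  have sxc: "((\<lambda>t. sx (c t)) has_real_derivative C t \<bullet> \<tau>) (at t)" 
    and htc: "((\<lambda>t. ht (c t)) has_real_derivative C t \<bullet> n) (at t)"  if "c differentiable (at t)" for t
    using bounded_linear.has_vector_derivative[OF bounded_linear_inner_left
        has_vector_derivative_diff[OF Cd[OF that] has_vector_derivative_const[of p0]]]
    unfolding sx_def ht_def has_real_derivative_iff_has_vector_derivative by simp_all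
  \<comment> \<open>The first derivative is needed at all \<open>t\<close> near 0 in order to be
    differentiated again at 0; at each such \<open>t\<close> the graph equation must hold on a
    neighbourhood of \<open>t\<close>.\<close>
  have "\<forall>\<^sub>F t in nhds 0. \<forall>\<^sub>F u in nhds t. c u \<in> ball p0 r \<and> c differentiable (at u) \<and> ht (c u) = \<phi> (sx (c u))"
    using ev1 by (simp add: eventually_eventually)
  then have ev2: "\<forall>\<^sub>F t in nhds 0. C t \<bullet> n = \<phi>1 (sx (c t)) * (C t \<bullet> \<tau>)"
  proof eventually_elim
    case (elim t)
    have t: "c t \<in> ball p0 r" "c differentiable (at t)" 
      using eventually_nhds_x_imp_x[OF elim] by auto
    have "((\<lambda>t. \<phi> (sx (c t))) has_real_derivative \<phi>1 (sx (c t)) * (C t \<bullet> \<tau>)) (at t)"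
      by (rule DERIV_chain2[OF \<phi>[OF abs_sx[OF t(1)]] sxc[OF t(2)]])
    moreover have "((\<lambda>t. \<phi> (sx (c t))) has_real_derivative C t \<bullet> n) (at t)"
      using htc[OF t(2)] elim by (subst DERIV_cong_ev[OF refl _ refl]) (auto elim: eventually_mono)
    ultimately show ?case using DERIV_unique by blast
  qed
  have C0: "C 0 = v" by (simp add: C_def v_def)
  show 1: "v \<bullet> n = \<phi>1 (sx p) * (v \<bullet> \<tau>)"
    using eventually_nhds_x_imp_x[OF ev2] C0 c0 by simp
  show "v \<bullet> \<tau> \<noteq> 0"
    using 1 v0 orthonormal_2_expansion[OF frame, of v] by auto
  have a': "((\<lambda>t. C t \<bullet> \<tau>) has_real_derivative a \<bullet> \<tau>) (at 0)" "((\<lambda>t. C t \<bullet> n) has_real_derivative a \<bullet> n) (at 0)"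
    using bounded_linear.has_vector_derivative[OF bounded_linear_inner_left a]
    unfolding C_def has_real_derivative_iff_has_vector_derivative by blast+
  have "((\<lambda>t. \<phi>1 (sx (c t))) has_real_derivative \<phi>2 (sx p) * (v \<bullet> \<tau>)) (at 0)"
    using DERIV_chain2[OF \<phi>1[OF abs_sx] sxc[OF \<open>c differentiable (at 0)\<close>]] p c0 C0 by simp
  from DERIV_mult[OF this a'(1)]
  have "((\<lambda>t. \<phi>1 (sx (c t)) * (C t \<bullet> \<tau>)) has_real_derivative 
      \<phi>2 (sx p) * (v \<bullet> \<tau>)\<^sup>2 + \<phi>1 (sx p) * (a \<bullet> \<tau>)) (at 0)"
    using c0 C0 by (simp add: power2_eq_square algebra_simps)
  then have "((\<lambda>t. C t \<bullet> n) has_real_derivative \<phi>2 (sx p) * (v \<bullet> \<tau>)\<^sup>2 + \<phi>1 (sx p) * (a \<bullet> \<tau>)) (at 0)"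
    using ev2 by (subst DERIV_cong_ev[OF refl _ refl])
  then show "a \<bullet> n = \<phi>2 (sx p) * (v \<bullet> \<tau>)\<^sup>2 + \<phi>1 (sx p) * (a \<bullet> \<tau>)"
    using a'(2) DERIV_unique by blast
qed

text \<open>Gives the existence half for both descriptions: the normal and the curvature quantify
  over curves, and the graph itself is one.\<close>

lemma regular_boundary_curve_graph:
  assumes "p \<in> frontier \<Omega>" "p \<in> ball p0 r"
  shows "regular_boundary_curve \<Omega> p (\<lambda>t. pt (sx p + t))"
proof -
  note g = graph_point[OF assms]
  obtain d where d: "d > 0" "\<And>s e. \<bar>s - sx p\<bar> < d \<Longrightarrow> \<bar>e\<bar> < d \<Longrightarrow> \<bar>s\<bar> < r \<and> pt s + e *\<^sub>R n \<in> ball p0 r"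
    using tube[of "sx p"] g assms by metis
  let ?c = "\<lambda>t. pt (sx p + t)" and ?c1 = "\<lambda>t. \<tau> + \<phi>1 (sx p + t) *\<^sub>R n"
  have near: "\<bar>sx p + t\<bar> < r" "?c t \<in> frontier \<Omega>" if "\<bar>t\<bar> < d" for t
    using d(2)[of "sx p + t" 0] that d(1) graph_frontier[of "?c t"] by auto
  have add: "((\<lambda>t. sx p + t) has_real_derivative 1) (at t)" for t
    by (auto intro!: derivative_eq_intros)
  have c1: "(?c has_vector_derivative ?c1 t) (at t)" if "\<bar>t\<bar> < d" for t
    using vector_diff_chain_at[of "\<lambda>t. sx p + t" 1 t pt, OF _ pt_deriv[OF near(1)[OF that]]] add[of t]
    by (simp add: o_def has_real_derivative_iff_has_vector_derivative)
  have c2: "(?c1 has_vector_derivative \<phi>2 (sx p) *\<^sub>R n) (at 0)"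
    using vector_diff_chain_at[of "\<lambda>t. sx p + t" 1 0 "\<lambda>s. \<tau> + \<phi>1 s *\<^sub>R n" "\<phi>2 (sx p) *\<^sub>R n"] pt_deriv2[OF g(2)] add[of 0]
    by (simp add: o_def has_real_derivative_iff_has_vector_derivative)
  have "((\<lambda>t. vector_derivative ?c (at t)) has_vector_derivative \<phi>2 (sx p) *\<^sub>R n) (at 0)"
  proof (rule has_vector_derivative_transform_within_open[OF c2, of "{-d<..<d}"])
    show "?c1 t = vector_derivative ?c (at t)" if "t \<in> {-d<..<d}" for t
      using that by (intro vector_derivative_at[OF c1, symmetric]) auto
  qed (use d(1) in auto)
  then have "(\<lambda>t. vector_derivative ?c (at t)) differentiable (at 0)"
    by (auto simp: differentiable_def has_vector_derivative_def)
  moreover have "\<forall>\<^sub>F t in nhds 0. ?c t \<in> frontier \<Omega> \<and> ?c differentiable (at t)"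
    unfolding eventually_nhds_metric
    using near(2) c1 d(1) by (intro exI[of _ d]) (auto simp: differentiable_def has_vector_derivative_def)
  moreover have "vector_derivative ?c (at 0) \<noteq> 0"
  proof -
    have "vector_derivative ?c (at 0) = ?c1 0" using c1[of 0] d(1) vector_derivative_at by auto
    moreover have "?c1 0 \<bullet> \<tau> = 1" by (simp add: inner_add_left)
    ultimately show ?thesis by (metis inner_zero_left zero_neq_one)
  qed
  ultimately show ?thesis unfolding regular_boundary_curve_def using g(1) by simp
qed

text \<open>The signed height \<open>g\<close> over the graph along the normal line has derivative
  \<open>(1 + (\<phi>1 s)\<^sup>2) / slope s = slope s > 0\<close> at 0, so the sign of the
  parameter decides the side.\<close>

lemma nu_points_outward:
  assumes "p \<in> frontier \<Omega>" "p \<in> ball p0 r"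
  shows "\<forall>\<^sub>F t in at_right 0. p - t *\<^sub>R nu (sx p) \<in> \<Omega> \<and> p + t *\<^sub>R nu (sx p) \<notin> closure \<Omega>"
proof -
  let ?s = "sx p"
  define g where "g t = ht (p + t *\<^sub>R nu ?s) - \<phi> (sx (p + t *\<^sub>R nu ?s))" for t
  have coords: "ht (p + t *\<^sub>R nu ?s) = \<phi> ?s + t / slope ?s" "sx (p + t *\<^sub>R nu ?s) = ?s + t * (- \<phi>1 ?s / slope ?s)" for t
    using graph_frontier[OF assms(2)] assms(1)
    by (auto simp: ht_def sx_def nu_def inner_add_left inner_diff_left)
  have w: "slope ?s \<noteq> 0" using slope(1)[of ?s] by simp
  have "(\<phi> has_real_derivative \<phi>1 ?s) (at (?s + 0 * (- \<phi>1 ?s / slope ?s)))"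
    using \<phi> graph_point(2)[OF assms] by simp
  moreover have "((\<lambda>t. ?s + t * (- \<phi>1 ?s / slope ?s)) has_real_derivative (- \<phi>1 ?s / slope ?s)) (at 0)"
    by (rule derivative_eq_intros refl | simp)+
  ultimately have "((\<lambda>t. \<phi> (?s + t * (- \<phi>1 ?s / slope ?s))) has_real_derivative \<phi>1 ?s * (- \<phi>1 ?s / slope ?s)) (at 0)"
    by (rule DERIV_chain2)
  then have "(g has_real_derivative (1 / slope ?s - \<phi>1 ?s * (- \<phi>1 ?s / slope ?s))) (at 0)"
    unfolding g_def coords using w by (auto intro!: derivative_eq_intros)
  moreover have "1 / slope ?s - \<phi>1 ?s * (- \<phi>1 ?s / slope ?s) = slope ?s"
    using slope[of ?s] by (simp add: field_simps power2_eq_square)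
  ultimately have g: "(g has_real_derivative slope ?s) (at 0)" by simp
  obtain d1 where d1: "d1 > 0" "\<And>t. 0 < t \<Longrightarrow> t < d1 \<Longrightarrow> g 0 < g (0 + t)"
    using DERIV_pos_inc_right[OF g slope(1)] by auto
  obtain d2 where d2: "d2 > 0" "\<And>t. 0 < t \<Longrightarrow> t < d2 \<Longrightarrow> g (0 - t) < g 0"
    using DERIV_pos_inc_left[OF g slope(1)] by auto
  have g0: "g 0 = 0" by (simp add: g_def graph_frontier[OF assms(2), THEN iffD1, OF assms(1)])
  have "((\<lambda>t. p + t *\<^sub>R nu ?s) \<longlongrightarrow> p) (at_right 0)" "((\<lambda>t. p - t *\<^sub>R nu ?s) \<longlongrightarrow> p) (at_right 0)"
    by (rule tendsto_eq_intros refl | simp)+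
  then have "\<forall>\<^sub>F t in at_right 0. p + t *\<^sub>R nu ?s \<in> ball p0 r" "\<forall>\<^sub>F t in at_right 0. p - t *\<^sub>R nu ?s \<in> ball p0 r"
    using topological_tendstoD[OF _ open_ball assms(2)] by blast+
  moreover have "\<forall>\<^sub>F t in at_right 0. t \<in> {0<..<min d1 d2}"
    using d1 d2 by (intro eventually_at_right_real) auto
  ultimately show ?thesis
  proof eventually_elim
    case (elim t)
    have "g t > 0" "g (- t) < 0" using d1(2)[of t] d2(2)[of t] g0 elim by auto
    then have "p + t *\<^sub>R nu ?s \<notin> closure \<Omega>" "p - t *\<^sub>R nu ?s \<in> interior \<Omega>"
      using elim above[of "p + t *\<^sub>R nu ?s"] below[of "p - t *\<^sub>R nu ?s"] by (auto simp: g_def)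
    then show ?case using interior_subset by blast
  qed
qed

lemma outward_normal_graph:
  assumes "p \<in> frontier \<Omega>" "p \<in> ball p0 r"
  shows "outward_normal \<Omega> p = nu (sx p)"
  unfolding outward_normal_def
proof (rule the_equality)
  let ?s = "sx p"
  have perp: "v \<bullet> nu ?s = 0 \<longleftrightarrow> v \<bullet> n = \<phi>1 ?s * (v \<bullet> \<tau>)" for v
    using slope(1)[of ?s] by (auto simp: nu_def inner_diff_right)
  show "norm (nu ?s) = 1 \<and> (\<exists>c. regular_boundary_curve \<Omega> p c \<and> vector_derivative c (at 0) \<bullet> nu ?s = 0) \<and>
      (\<forall>\<^sub>F t in at_right 0. p - t *\<^sub>R nu ?s \<in> \<Omega> \<and> p + t *\<^sub>R nu ?s \<notin> closure \<Omega>)"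
    using frame_nu(1) nu_points_outward[OF assms] regular_boundary_curve_graph[OF assms]
      regular_boundary_curve_derivatives(1)[OF assms(2)] perp by blast
  fix \<nu> assume \<nu>: "norm \<nu> = 1 \<and> (\<exists>c. regular_boundary_curve \<Omega> p c \<and> vector_derivative c (at 0) \<bullet> \<nu> = 0) \<and>
      (\<forall>\<^sub>F t in at_right 0. p - t *\<^sub>R \<nu> \<in> \<Omega> \<and> p + t *\<^sub>R \<nu> \<notin> closure \<Omega>)"
  then obtain c where c: "regular_boundary_curve \<Omega> p c" "vector_derivative c (at 0) \<bullet> \<nu> = 0" by blast
  \<comment> \<open>A competitor is a unit vector orthogonal to a nonzero tangent \<open>v\<close>,
    hence plus or minus \<open>nu\<close>. The minus sign would place points of the outer normal ray
    in \<open>\<Omega>\<close>.\<close>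
  define v where "v = vector_derivative c (at 0)"
  have v: "v \<noteq> 0" "v \<bullet> nu ?s = 0" "v \<bullet> \<nu> = 0"
    using c regular_boundary_curve_derivatives(1)[OF assms(2) c(1)] perp
    by (auto simp: v_def regular_boundary_curve_def)
  define e where "e = v /\<^sub>R norm v"
  have "norm e = 1" "e \<bullet> nu ?s = 0" "\<nu> \<bullet> e = 0"
    using v by (auto simp: e_def inner_commute)
  then have eq: "\<nu> = (\<nu> \<bullet> nu ?s) *\<^sub>R nu ?s"
    using orthonormal_2_expansion[of e "nu ?s" \<nu>] frame_nu(1) by simp
  then have "\<bar>\<nu> \<bullet> nu ?s\<bar> = 1" using \<nu> frame_nu(1) by (metis norm_scaleR mult.right_neutral)
  moreover have "\<nu> \<bullet> nu ?s \<noteq> -1"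
  proof
    assume "\<nu> \<bullet> nu ?s = -1"
    then have "\<nu> = - nu ?s" using eq by simp
    then have "\<forall>\<^sub>F t in at_right 0. p + t *\<^sub>R nu ?s \<in> \<Omega>"
      using \<nu> by (auto elim: eventually_mono)
    with nu_points_outward[OF assms] have "\<forall>\<^sub>F t in at_right (0::real). False"
      by eventually_elim (use closure_subset in blast)
    then show False by simp
  qed
  ultimately have "\<nu> \<bullet> nu ?s = 1" by linarith
  then show "\<nu> = nu ?s" using eq by simp
qed

text \<open>Reparametrising a curve multiplies \<open>v\<close> by a factor, which cancels as a
  square in the quotient, and adds to \<open>a\<close> a tangential vector, which \<open>nu\<close>
  annihilates. Hence every admissible curve yields the same number.\<close>

lemma boundary_curvature_graph:
  assumes "p \<in> frontier \<Omega>" "p \<in> ball p0 r"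
  shows "boundary_curvature \<Omega> p = curv (sx p)"
proof -
  have *: "curv (sx p) = - (vector_derivative (\<lambda>t. vector_derivative c (at t)) (at 0) \<bullet> outward_normal \<Omega> p)
           / (norm (vector_derivative c (at 0)))\<^sup>2" if "regular_boundary_curve \<Omega> p c" for c
  proof -
    let ?s = "sx p"
    define v where "v = vector_derivative c (at 0)"
    define a where "a = vector_derivative (\<lambda>t. vector_derivative c (at t)) (at 0)"
    have d: "v \<bullet> n = \<phi>1 ?s * (v \<bullet> \<tau>)" "v \<bullet> \<tau> \<noteq> 0" "a \<bullet> n = \<phi>2 ?s * (v \<bullet> \<tau>)\<^sup>2 + \<phi>1 ?s * (a \<bullet> \<tau>)"
      using regular_boundary_curve_derivatives[OF assms(2) that] by (simp_all add: v_def a_def)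
    have "v = (v \<bullet> \<tau>) *\<^sub>R (\<tau> + \<phi>1 ?s *\<^sub>R n)"
      using orthonormal_2_expansion[OF frame, of v] d(1) by (simp add: algebra_simps)
    moreover have "(norm (\<tau> + \<phi>1 ?s *\<^sub>R n))\<^sup>2 = (slope ?s)\<^sup>2"
      unfolding power2_norm_eq_inner by (simp add: algebra_simps slope power2_eq_square[of "slope ?s"] power2_eq_square[of "\<phi>1 ?s"])
    ultimately have v: "(norm v)\<^sup>2 = (v \<bullet> \<tau>)\<^sup>2 * (slope ?s)\<^sup>2"
      by (metis norm_scaleR power2_abs power_mult_distrib)
    have "a \<bullet> nu ?s = \<phi>2 ?s * (v \<bullet> \<tau>)\<^sup>2 / slope ?s"
      using d(3) by (simp add: nu_def inner_diff_right)
    then have "- (a \<bullet> nu ?s) / (norm v)\<^sup>2 = curv ?s"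
      using d(2) slope(1)[of ?s] unfolding v by (simp add: curv_def power2_eq_square power3_eq_cube)
    then show ?thesis using outward_normal_graph[OF assms] by (simp add: v_def a_def)
  qed
  then show ?thesis
    unfolding boundary_curvature_def
    using regular_boundary_curve_graph[OF assms] by (intro the_equality) (blast, metis)
qed

text \<open>The Laplacian is the trace in the frame of unit tangent and normal. Its tangential part
  is, by the twice differentiated boundary condition, minus the gradient times the curve's second
  derivative over the squared speed, which is curvature times \<open>k\<close>. One statement serves
  both sides, with the normal always pointing out of \<Omega>.\<close>

lemma normal_relation:
  assumes p: "p \<in> frontier \<Omega>" "p \<in> ball p0 r"
    and S: "S = \<Omega> \<or> S = - closure \<Omega>" "open S"
    and u: "C2_up_to_boundary S u" "\<And>x. x \<in> S \<Longrightarrow> laplacian u x = l" "\<And>x. x \<in> frontier \<Omega> \<Longrightarrow> u x = 0"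
  obtains k where "boundary_value S (gradient u) p = k *\<^sub>R outward_normal \<Omega> p"
    "normal_second_derivative \<Omega> S u p + boundary_curvature \<Omega> p * k = l"
proof -
  note g = graph_point[OF p]
  \<comment> \<open>The sign selects the vertical shift that enters \<open>S\<close>: downward for
    the inside, upward for the outside.\<close>
  let ?s = "sx p" and ?\<sigma> = "if S = \<Omega> then -1 else 1 :: real"
  obtain d where d: "d > 0" "\<And>s e. \<bar>s - ?s\<bar> < d \<Longrightarrow> \<bar>e\<bar> < d \<Longrightarrow> \<bar>s\<bar> < r \<and> pt s + e *\<^sub>R n \<in> ball p0 r"
    using tube[of ?s] g p by metis
  have side: "pt s + e *\<^sub>R (?\<sigma> *\<^sub>R n) \<in> S" if "\<bar>s - ?s\<bar> < d" "0 < e" "e < d" for s e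
  proof (cases "S = \<Omega>")
    case True
    have "pt s + (-e) *\<^sub>R n \<in> interior \<Omega>"
      using d(2)[OF that(1), of "-e"] that coords_shift(1,2)[of "pt s" "-e"] coords_shift(3,4)[of s]
      by (intro below) auto
    then show ?thesis using True interior_subset[of \<Omega>] by auto
  next
    case False
    then show ?thesis using S(1) d(2)[OF that(1), of e] that above[of "pt s + e *\<^sub>R n"] by auto
  qed
  have on: "pt s \<in> frontier \<Omega>" if "\<bar>s - ?s\<bar> < d" for s
    using d(2)[OF that, of 0] d(1) graph_frontier[of "pt s"] by simp
  obtain G H where GH: "continuous_on (closure S) u" "continuous_on (closure S) G" "continuous_on (closure S) H"
    "\<And>x. x \<in> S \<Longrightarrow> G x = gradient u x" "\<And>x. x \<in> S \<Longrightarrow> H x = hessian u x"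
    "\<And>x. x \<in> S \<Longrightarrow> GDERIV u x :> G x" "\<And>x. x \<in> S \<Longrightarrow> (G has_derivative (\<lambda>h. H x *v h)) (at x)"
    using C2_up_to_boundary_extension[OF S(2) u(1)] by metis
  have dr: "\<bar>s\<bar> < r" if "\<bar>s - ?s\<bar> < d" for s
    using d(2)[OF that, of 0] d(1) by simp
  have "{?s - d<..<?s + d} \<subseteq> {-r<..<r}"
  proof
    fix s assume "s \<in> {?s - d<..<?s + d}"
    then show "s \<in> {-r<..<r}" using dr[of s] by (simp add: abs_less_iff)
  qed
  then have c2: "continuous_on {?s - d<..<?s + d} (\<lambda>s. \<phi>2 s *\<^sub>R n)"
    by (intro continuous_on_scaleR continuous_on_subset[OF \<phi>2] continuous_on_const)
  have der: "(pt has_vector_derivative \<tau> + \<phi>1 s *\<^sub>R n) (at s)"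
    "((\<lambda>s. \<tau> + \<phi>1 s *\<^sub>R n) has_vector_derivative \<phi>2 s *\<^sub>R n) (at s)" if "\<bar>s - ?s\<bar> < d" for s
    using pt_deriv[OF dr[OF that]] pt_deriv2[OF dr[OF that]] by auto
  let ?v = "\<tau> + \<phi>1 ?s *\<^sub>R n"
  have T: "G p \<bullet> ?v = 0" "?v \<bullet> (H p *v ?v) + G p \<bullet> (\<phi>2 ?s *\<^sub>R n) = 0"
    using boundary_tangential_derivatives[OF d(1) der(1) der(2) c2 side GH(1) u(3)[OF on] GH(2,6,3,7)]
    unfolding g(1)[symmetric] by simp_all
  have pcl: "p \<in> closure S"
  proof (rule Lim_in_closed_set[OF closed_closure _ trivial_limit_at_right_real])
    show "((\<lambda>e. pt ?s + e *\<^sub>R (?\<sigma> *\<^sub>R n)) \<longlongrightarrow> p) (at_right 0)"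
      unfolding g(1)[symmetric] by (rule tendsto_eq_intros refl | simp)+
    have "\<forall>\<^sub>F e in at_right 0. e \<in> {0<..<d}" using d(1) by (rule eventually_at_right_real)
    then show "\<forall>\<^sub>F e in at_right 0. pt ?s + e *\<^sub>R (?\<sigma> *\<^sub>R n) \<in> closure S"
    proof eventually_elim
      case (elim e)
      then have "pt ?s + e *\<^sub>R (?\<sigma> *\<^sub>R n) \<in> S" using d(1) by (intro side) auto
      then show ?case using closure_subset by blast
    qed
  qed
  have pS: "p \<notin> S" using p(1) S by (auto simp: frontier_def interior_open)
  have bG: "boundary_value S (gradient u) p = G p" by (rule boundary_value_eq[OF GH(2,4) pcl pS])
  have bH: "boundary_value S (hessian u) p = H p" by (rule boundary_value_eq[OF GH(3,5) pcl pS])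
  \<comment> \<open>The equation is given only in \<open>S\<close>; continuity of \<open>H\<close>
    extends it to the boundary.\<close>
  have "trace (H p) = l"
  proof (rule continuous_constant_on_closure[of S "\<lambda>x. trace (H x)"])
    show "continuous_on (closure S) (\<lambda>x. trace (H x))"
      unfolding trace_def by (intro continuous_intros GH)
  qed (use GH(5) u(2) pcl in \<open>auto simp: laplacian_def\<close>)
  have w: "slope ?s > 0" by (rule slope)
  let ?a = "(1 / slope ?s) *\<^sub>R ?v"
  have vv: "?v \<bullet> ?v = slope ?s * slope ?s" unfolding slope(2) by (simp add: algebra_simps power2_eq_square)
  have "?a \<bullet> ?a = (1 / slope ?s) * ((1 / slope ?s) * (?v \<bullet> ?v))"
    by (simp only: inner_scaleR_left inner_scaleR_right)
  also have "\<dots> = 1" unfolding vv using w by simp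
  finally have "?a \<bullet> ?a = 1" .
  then have a1: "norm ?a = 1" by (simp only: norm_eq_1)
  have a2: "?a \<bullet> nu ?s = 0" using frame_nu(2)[of ?s] by (simp only: inner_scaleR_left inner_commute) simp
  define k where "k = G p \<bullet> nu ?s"
  have Gk: "G p = k *\<^sub>R nu ?s"
    using orthonormal_2_expansion[OF a1 frame_nu(1) a2, of "G p"] T(1) by (simp add: k_def)
  then have Gn: "G p \<bullet> n = k / slope ?s"
    by (simp add: nu_def inner_diff_left)
  have "?a \<bullet> (H p *v ?a) = (?v \<bullet> (H p *v ?v)) / (slope ?s)\<^sup>2"
    by (simp only: matrix_vector_mult_scaleR inner_scaleR_left inner_scaleR_right) (simp add: power2_eq_square)
  also have "?v \<bullet> (H p *v ?v) = - \<phi>2 ?s * (k / slope ?s)"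
    using T(2) Gn by simp
  finally have "?a \<bullet> (H p *v ?a) = curv ?s * k"
    by (simp add: curv_def power2_eq_square power3_eq_cube)
  then have "nu ?s \<bullet> (H p *v nu ?s) + curv ?s * k = l"
    using trace_orthonormal_2[OF a1 frame_nu(1) a2, of "H p"] \<open>trace (H p) = l\<close> by simp
  then show ?thesis
    using Gk by (intro that[of k])
      (simp_all add: normal_second_derivative_def bG bH outward_normal_graph[OF p] boundary_curvature_graph[OF p])
qed

section \<open>Continuity of the curvature and constancy of the centre\<close>

lemma continuous_curv: "continuous_on {-r<..<r} curv"
  unfolding curv_def slope_def
  by (intro continuous_intros \<phi>2 continuous_\<phi>1) (auto simp: add_nonneg_eq_0_iff sum_power2_eq_zero_iff add_pos_nonneg less_imp_neq[symmetric])

lemma continuous_boundary_curvature: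
  assumes "p0 \<in> frontier \<Omega>"
  shows "continuous (at p0 within frontier \<Omega>) (boundary_curvature \<Omega>)"
proof (rule continuous_transform_within[OF _ r_pos assms])
  have "isCont curv (sx p0)"
    using continuous_curv r_pos by (simp add: continuous_on_eq_continuous_at sx_def)
  moreover have "continuous (at p0 within frontier \<Omega>) sx"
    unfolding sx_def by (intro continuous_intros)
  ultimately show "continuous (at p0 within frontier \<Omega>) (\<lambda>x. curv (sx x))"
    by (rule continuous_within_compose3)
  show "curv (sx x) = boundary_curvature \<Omega> x" if "x \<in> frontier \<Omega>" "dist x p0 < r" for x
    using boundary_curvature_graph[OF that(1)] that(2) by (simp add: dist_commute)
qed

text \<open>Where the curvature is constant, \<open>\<nu>' = \<kappa> c'\<close> along the boundary.\<close>

lemma centre_locally_constant: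
  assumes p0: "p0 \<in> frontier \<Omega>" and \<kappa>: "\<And>p. p \<in> frontier \<Omega> \<Longrightarrow> boundary_curvature \<Omega> p = \<kappa>"
  shows "\<forall>\<^sub>F p in at p0 within frontier \<Omega>. \<kappa> *\<^sub>R p - outward_normal \<Omega> p = \<kappa> *\<^sub>R p0 - outward_normal \<Omega> p0"
proof -
  have p0b: "p0 \<in> ball p0 r" using r_pos by simp
  have s0: "sx p0 = 0" by (simp add: sx_def)
  obtain d where d: "d > 0" "\<And>s e. \<bar>s - sx p0\<bar> < d \<Longrightarrow> \<bar>e\<bar> < d \<Longrightarrow> \<bar>s\<bar> < r \<and> pt s + e *\<^sub>R n \<in> ball p0 r"
    using tube[of "sx p0"] graph_point[OF p0 p0b] p0b by metis
  have d': "\<bar>s\<bar> < r" "pt s \<in> ball p0 r" if "\<bar>s\<bar> < d" for s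
    using d(2)[of s 0] that d(1) s0 by auto
  define V where "V s = \<kappa> *\<^sub>R pt s - nu s" for s
  have Vd: "(V has_vector_derivative 0) (at s)" if s: "\<bar>s\<bar> < d" for s
  proof -
    note sr = d'[OF s]
    have "curv s = \<kappa>"
      using \<kappa> boundary_curvature_graph[of "pt s"] graph_frontier[OF sr(2)] sr(2) by simp
    \<comment> \<open>With this value of \<open>\<phi>2\<close>, the components
      \<open>1 / slope\<close> and \<open>\<phi>1 / slope\<close> of the normal have derivatives
      \<open>\<kappa> * \<phi>1\<close> and \<open>- \<kappa>\<close>.\<close>
    then have k: "\<phi>2 s = - \<kappa> * slope s ^ 3" using slope(1)[of s] by (auto simp: curv_def field_simps)
    have pos: "1 + (\<phi>1 s)\<^sup>2 > 0" by (simp add: add_pos_nonneg)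
    have "((\<lambda>s. 1 + (\<phi>1 s)\<^sup>2) has_real_derivative 2 * \<phi>1 s * \<phi>2 s) (at s)"
      by (rule derivative_eq_intros refl \<phi>1[OF sr(1)] | simp)+
    from DERIV_chain2[OF DERIV_real_sqrt[OF pos] this]
    have sl: "(slope has_real_derivative \<phi>1 s * \<phi>2 s / slope s) (at s)"
      unfolding slope_def by (simp add: field_simps)
    have w: "slope s > 0" "slope s \<noteq> 0" using slope(1)[of s] by auto
    have A: "((\<lambda>s. 1 / slope s) has_real_derivative \<kappa> * \<phi>1 s) (at s)"
      using w by (auto intro!: derivative_eq_intros sl simp: k field_simps power3_eq_cube)
    have "((\<lambda>s. (1 / slope s) * \<phi>1 s) has_real_derivative \<kappa> * \<phi>1 s * \<phi>1 s + \<phi>2 s * (1 / slope s)) (at s)"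
      using DERIV_mult[OF A \<phi>1[OF sr(1)]] .
    moreover have "\<kappa> * \<phi>1 s * \<phi>1 s + \<phi>2 s * (1 / slope s) = - \<kappa>"
    proof -
      have "\<phi>2 s * (1 / slope s) = - \<kappa> * (slope s * slope s)" using w by (simp add: k power3_eq_cube)
      then show ?thesis using slope(2)[of s] by (simp add: algebra_simps power2_eq_square)
    qed
    ultimately have B: "((\<lambda>s. (1 / slope s) * \<phi>1 s) has_real_derivative - \<kappa>) (at s)" by simp
    have "((\<lambda>s. (1 / slope s) *\<^sub>R n - ((1 / slope s) * \<phi>1 s) *\<^sub>R \<tau>) has_vector_derivative
        (\<kappa> * \<phi>1 s) *\<^sub>R n - (- \<kappa>) *\<^sub>R \<tau>) (at s)"
      using has_vector_derivative_diff[OF has_vector_derivative_scaleR[OF A has_vector_derivative_const]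
          has_vector_derivative_scaleR[OF B has_vector_derivative_const]] by simp
    then have "(nu has_vector_derivative \<kappa> *\<^sub>R (\<tau> + \<phi>1 s *\<^sub>R n)) (at s)"
      unfolding nu_def by (simp add: scaleR_diff_right algebra_simps)
    moreover have "((\<lambda>s. \<kappa> *\<^sub>R pt s) has_vector_derivative \<kappa> *\<^sub>R (\<tau> + \<phi>1 s *\<^sub>R n)) (at s)"
      using has_vector_derivative_scaleR[OF DERIV_const pt_deriv[OF sr(1)], of \<kappa>] by simp
    ultimately show ?thesis
      unfolding V_def using has_vector_derivative_diff by fastforce
  qed
  have const: "V s = V 0" if "\<bar>s\<bar> < d" for s
  proof -
    have "(V has_vector_derivative 0) (at t within {-d<..<d})" if "t \<in> {-d<..<d}" for t
      using that by (intro has_vector_derivative_at_within[OF Vd]) auto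
    then obtain c where c: "\<And>t. t \<in> {-d<..<d} \<Longrightarrow> V t = c"
      using has_vector_derivative_zero_constant[OF convex_real_interval(8), of "-d" d V] by blast
    then show ?thesis using c[of s] c[of 0] that d(1) by (simp add: abs_less_iff)
  qed
  have "\<forall>\<^sub>F p in at p0 within frontier \<Omega>. dist p p0 < min d r"
    unfolding eventually_at using d(1) r_pos by (intro exI[of _ "min d r"]) auto
  moreover have "\<forall>\<^sub>F p in at p0 within frontier \<Omega>. p \<in> frontier \<Omega>"
    by (auto simp: eventually_at_filter)
  ultimately show ?thesis
  proof eventually_elim
    case (elim p)
    then have p: "p \<in> ball p0 r" by (simp add: dist_commute)
    have "\<bar>sx p\<bar> < d"
      using elim(1) Cauchy_Schwarz_ineq2[of "p - p0" \<tau>] frame(1) by (simp add: sx_def dist_norm)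
    then have "V (sx p) = V (sx p0)" using const[of "sx p"] s0 by simp
    then show ?case
      using graph_point(1)[OF elim(2) p] graph_point(1)[OF p0 p0b]
        outward_normal_graph[OF elim(2) p] outward_normal_graph[OF p0 p0b]
      by (simp add: V_def)
  qed
qed

end


lemma Ck_holder_boundary_graph_chart:
  assumes "Ck_holder_boundary 3 \<alpha> \<Omega>" "p \<in> frontier \<Omega>"
  obtains \<tau> n r \<phi> \<phi>1 \<phi>2 where "graph_chart \<Omega> p \<tau> n r \<phi> \<phi>1 \<phi>2"
proof -
  obtain \<tau> n r \<phi> where c: "norm \<tau> = 1" "norm n = 1" "\<tau> \<bullet> n = 0" "r > 0" "Ck_holder_on 3 \<alpha> {-r<..<r} \<phi>"
    "\<And>x. x \<in> ball p r \<Longrightarrow> x \<in> \<Omega> \<longleftrightarrow> (x - p) \<bullet> n < \<phi> ((x - p) \<bullet> \<tau>)"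
    using assms unfolding Ck_holder_boundary_def by blast
  have d: "(deriv ^^ j) \<phi> differentiable (at t)" if "j < 3" "\<bar>t\<bar> < r" for j t
    using c(5) that unfolding Ck_holder_on_def by (auto simp: abs_less_iff)
  have diff: "(f has_real_derivative deriv f t) (at t)" if "f differentiable (at t)" for f t
    using that by (simp add: DERIV_deriv_iff_real_differentiable)
  have "graph_chart \<Omega> p \<tau> n r \<phi> (deriv \<phi>) (deriv (deriv \<phi>))"
  proof
    show "(\<phi> has_real_derivative deriv \<phi> s) (at s)" if "\<bar>s\<bar> < r" for s
      using d[of 0, OF _ that] diff by simp
    show "(deriv \<phi> has_real_derivative deriv (deriv \<phi>) s) (at s)" if "\<bar>s\<bar> < r" for s
      using d[of 1, OF _ that] diff by simp
    \<comment> \<open>The second derivative is continuous because it is itself differentiable, which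
      is the case \<open>j = 2\<close> of the regularity condition.\<close>
    show "continuous_on {- r<..<r} (deriv (deriv \<phi>))"
    proof (intro continuous_at_imp_continuous_on ballI)
      fix s assume "s \<in> {-r<..<r}"
      then show "isCont (deriv (deriv \<phi>)) s"
        using d[of 2 s] by (intro differentiable_imp_continuous_within) (auto simp: numeral_2_eq_2)
    qed
  qed (use c in auto)
  then show ?thesis by (rule that)
qed

section \<open>Constant curvature\<close>

lemma outward_normal_properties:
  assumes "Ck_holder_boundary 3 \<alpha> \<Omega>" "p \<in> frontier \<Omega>"
  shows "norm (outward_normal \<Omega> p) = 1" "\<forall>\<^sub>F t in at_right 0. p - t *\<^sub>R outward_normal \<Omega> p \<in> \<Omega>"
proof -
  obtain \<tau> n r \<phi> \<phi>1 \<phi>2 where "graph_chart \<Omega> p \<tau> n r \<phi> \<phi>1 \<phi>2"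
    using Ck_holder_boundary_graph_chart[OF assms] .
  then interpret graph_chart \<Omega> p \<tau> n r \<phi> \<phi>1 \<phi>2 .
  have pb: "p \<in> ball p r" using r_pos by simp
  show "norm (outward_normal \<Omega> p) = 1"
    unfolding outward_normal_graph[OF assms(2) pb] by (rule frame_nu)
  show "\<forall>\<^sub>F t in at_right 0. p - t *\<^sub>R outward_normal \<Omega> p \<in> \<Omega>"
    unfolding outward_normal_graph[OF assms(2) pb]
    using nu_points_outward[OF assms(2) pb] by (rule eventually_mono) simp
qed

text \<open>A connected set that meets both \<open>S\<close> and its complement meets the frontier.
  The exterior of the closed ball is connected in dimension at least two and too large to lie in the
  bounded \<open>S\<close>, so it misses \<open>S\<close>; the open ball meets \<open>S\<close>, so
  it is contained in it.\<close>

lemma frontier_in_sphere_imp_ball: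
  fixes S :: "'a::euclidean_space set"
  assumes "open S" "bounded S" "connected S" "S \<noteq> {}" "frontier S \<subseteq> sphere z R" "2 \<le> DIM('a)"
  shows "S = ball z R"
proof -
  have disj: "- cball z R \<inter> S = {}"
  proof (rule ccontr)
    assume "- cball z R \<inter> S \<noteq> {}"
    moreover have "- cball z R - S \<noteq> {}"
    proof
      assume "- cball z R - S = {}"
      then have "UNIV \<subseteq> S \<union> cball z R" by blast
      then have "bounded (UNIV :: 'a set)" using assms(2) by (meson bounded_Un bounded_cball bounded_subset)
      then show False using not_bounded_UNIV by blast
    qed
    ultimately have "- cball z R \<inter> frontier S \<noteq> {}"
      using connected_complement_bounded_convex[OF bounded_cball convex_cball assms(6)] connected_Int_frontier by blast
    then show False using assms(5) by auto
  qed
  then have "S \<subseteq> interior (cball z R)" using assms(1) by (intro interior_maximal) auto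
  then have sub: "S \<subseteq> ball z R" by simp
  have "ball z R - S = {}"
  proof (rule ccontr)
    assume "ball z R - S \<noteq> {}"
    moreover have "ball z R \<inter> S \<noteq> {}" using sub assms(4) by blast
    ultimately have "ball z R \<inter> frontier S \<noteq> {}" using connected_ball connected_Int_frontier by blast
    then show False using assms(5) by auto
  qed
  with sub show ?thesis by blast
qed

text \<open>Divided by \<open>\<kappa>\<close>, the constant vector \<open>V\<close> is the common
  centre of curvature, and each boundary point is at distance
  \<open>1 / \<bar>\<kappa>\<bar>\<close> from it.\<close>

lemma constant_curvature_imp_ball:
  assumes \<Omega>: "open \<Omega>" "\<Omega> \<noteq> {}" "bounded \<Omega>" "connected \<Omega>" "connected (frontier \<Omega>)"
    and C: "Ck_holder_boundary 3 \<alpha> \<Omega>" and \<kappa>: "\<And>p. p \<in> frontier \<Omega> \<Longrightarrow> boundary_curvature \<Omega> p = \<kappa>"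
  obtains z R where "R > 0" "\<Omega> = ball z R"
proof -
  note nu = outward_normal_properties[OF C]
  have loc: "\<forall>p\<in>frontier \<Omega>. \<forall>\<^sub>F x in at p within frontier \<Omega>.
      \<kappa> *\<^sub>R p - outward_normal \<Omega> p = \<kappa> *\<^sub>R x - outward_normal \<Omega> x"
  proof
    fix p assume p: "p \<in> frontier \<Omega>"
    obtain \<tau> n r \<phi> \<phi>1 \<phi>2 where "graph_chart \<Omega> p \<tau> n r \<phi> \<phi>1 \<phi>2"
      using Ck_holder_boundary_graph_chart[OF C p] .
    then interpret graph_chart \<Omega> p \<tau> n r \<phi> \<phi>1 \<phi>2 .
    show "\<forall>\<^sub>F x in at p within frontier \<Omega>. \<kappa> *\<^sub>R p - outward_normal \<Omega> p = \<kappa> *\<^sub>R x - outward_normal \<Omega> x"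
      using centre_locally_constant[OF p \<kappa>] by (rule eventually_mono) simp_all
  qed
  have ne: "frontier \<Omega> \<noteq> {}" using \<Omega>(2,3) by (metis frontier_not_empty not_bounded_UNIV)
  then obtain p0 where p0: "p0 \<in> frontier \<Omega>" by blast
  define V where "V = \<kappa> *\<^sub>R p0 - outward_normal \<Omega> p0"
  have V: "\<kappa> *\<^sub>R p - outward_normal \<Omega> p = V" if "p \<in> frontier \<Omega>" for p
    unfolding V_def using connected_local_const[OF \<Omega>(5) that p0 loc] .
  \<comment> \<open>Otherwise the outward normal would be \<open>- V\<close> along the whole
    boundary. A maximiser of \<open>y \<bullet> V\<close> on the compact closure could then still be
    moved a little along \<open>V\<close> within \<open>\<Omega>\<close>: by openness inside, and
    against the outward normal on the boundary.\<close>
  have "\<kappa> \<noteq> 0"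
  proof
    assume "\<kappa> = 0"
    then have n: "outward_normal \<Omega> p = - V" if "p \<in> frontier \<Omega>" for p using V[OF that, symmetric] by simp
    have V1: "norm V = 1" using nu(1)[OF p0] n[OF p0] by simp
    have "compact (closure \<Omega>)" "closure \<Omega> \<noteq> {}" using \<Omega> by (auto simp: compact_closure)
    moreover have "continuous_on (closure \<Omega>) (\<lambda>y. y \<bullet> V)" by (intro continuous_intros)
    ultimately have "\<exists>x\<in>closure \<Omega>. \<forall>y\<in>closure \<Omega>. y \<bullet> V \<le> x \<bullet> V"
      by (rule continuous_attains_sup)
    then obtain x where x: "x \<in> closure \<Omega>" "\<And>y. y \<in> closure \<Omega> \<Longrightarrow> y \<bullet> V \<le> x \<bullet> V" by blast
    have "\<forall>\<^sub>F t in at_right 0. x + t *\<^sub>R V \<in> \<Omega>"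
    proof (cases "x \<in> \<Omega>")
      case True
      have "((\<lambda>t. x + t *\<^sub>R V) \<longlongrightarrow> x) (at_right 0)" by (rule tendsto_eq_intros refl | simp)+
      then show ?thesis using topological_tendstoD[OF _ \<Omega>(1) True] by blast
    next
      case False
      then have "x \<in> frontier \<Omega>" using x(1) \<Omega>(1) by (simp add: frontier_def interior_open)
      then show ?thesis using nu(2)[of x] n[of x] by simp
    qed
    then have "\<forall>\<^sub>F t in at_right (0::real). False"
      using eventually_at_right_less[of 0]
    proof eventually_elim
      case (elim t)
      then have "(x + t *\<^sub>R V) \<bullet> V \<le> x \<bullet> V" using x(2) closure_subset by blast
      moreover have "V \<bullet> V = 1" using V1 by (simp add: norm_eq_1)
      ultimately show ?case using elim by (simp add: inner_add_left)
    qed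
    then show False by simp
  qed
  have "frontier \<Omega> \<subseteq> sphere ((1 / \<kappa>) *\<^sub>R V) (1 / \<bar>\<kappa>\<bar>)"
  proof
    fix p assume p: "p \<in> frontier \<Omega>"
    have "(1 / \<kappa>) *\<^sub>R V - p = - ((1 / \<kappa>) *\<^sub>R outward_normal \<Omega> p)"
      using \<open>\<kappa> \<noteq> 0\<close> unfolding V[OF p, symmetric] by (simp add: scaleR_diff_right)
    then show "p \<in> sphere ((1 / \<kappa>) *\<^sub>R V) (1 / \<bar>\<kappa>\<bar>)"
      using nu(1)[OF p] by (simp add: dist_norm)
  qed
  then have "\<Omega> = ball ((1 / \<kappa>) *\<^sub>R V) (1 / \<bar>\<kappa>\<bar>)"
    using \<Omega> by (intro frontier_in_sphere_imp_ball) auto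
  then show ?thesis using that[of "1 / \<bar>\<kappa>\<bar>"] \<open>\<kappa> \<noteq> 0\<close> by simp
qed

section \<open>Uniqueness for the Dirichlet problem\<close>

lemma harmonic_zero_boundary:
  fixes u :: "'a::euclidean_space \<Rightarrow> real"
  assumes S: "open S" "bounded S" and u: "has_laplacian_on u (\<lambda>x. 0) S" "continuous_on (closure S) u"
    and bd: "\<And>x. x \<in> frontier S \<Longrightarrow> u x = 0" and x: "x \<in> closure S"
  shows "u x = 0"
proof -
  have "u x \<le> 0" by (rule maximum_principle[OF S u _ x]) (simp add: bd)
  moreover have "- 1 * u x \<le> 0"
  proof (rule maximum_principle[OF S _ _ _ x])
    show "has_laplacian_on (\<lambda>x. - 1 * u x) (\<lambda>x. 0) S"
      using has_laplacian_on_cmult[OF u(1), of "-1"] by simp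
    show "continuous_on (closure S) (\<lambda>x. - 1 * u x)" by (intro continuous_intros u)
  qed (simp add: bd)
  ultimately show ?thesis by simp
qed

text \<open>The barrier \<open>\<epsilon> ln (dist z x / R)\<close> is harmonic in the plane and tends to infinity, so it
  dominates any bounded harmonic function on large circles.\<close>

lemma exterior_bounded_harmonic_nonpos:
  fixes w :: "real^2 \<Rightarrow> real"
  assumes R: "R > 0" and w: "has_laplacian_on w (\<lambda>x. 0) (- cball z R)" "continuous_on (- ball z R) w"
    and bd: "\<And>x. x \<in> sphere z R \<Longrightarrow> w x \<le> 0"
    and M: "\<And>x. norm x \<ge> B \<Longrightarrow> w x \<le> M" and x: "x \<notin> ball z R"
  shows "w x \<le> 0"
proof -
  define L where "L y = ln (dist z y) - ln R" for y
  have "ln R \<le> ln (dist z x)" using x R by (subst ln_le_cancel_iff) auto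
  then have L0: "L x \<ge> 0" by (simp add: L_def)
  have *: "w x \<le> e * L x" if e: "e > 0" for e
  proof -
    \<comment> \<open>The radius must enclose \<open>x\<close>, exceed \<open>R\<close>, reach the
      region where \<open>M\<close> bounds \<open>w\<close> even though that region is centred at
      the origin, and be so large that \<open>e * ln (T / R)\<close> is at least
      \<open>M\<close>.\<close>
    define T where "T = Max {dist z x + 1, R + 1, B + norm z, R * exp (M / e)}"
    have T: "dist z x < T" "R < T" "B + norm z \<le> T" "R * exp (M / e) \<le> T"
    proof -
      have "dist z x + 1 \<le> T" "R + 1 \<le> T" "B + norm z \<le> T" "R * exp (M / e) \<le> T"
        unfolding T_def by (intro Max_ge; simp)+
      then show "dist z x < T" "R < T" "B + norm z \<le> T" "R * exp (M / e) \<le> T" by auto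
    qed
    let ?S = "ball z T - cball z R"
    define v where "v y = w y + (- e) * ln (dist z y) + e * ln R" for y
    have S: "open ?S" "bounded ?S" by (auto intro: bounded_subset[OF bounded_ball])
    have "closed (cball z T - ball z R)" by (intro closed_Diff) auto
    then have cl: "closure ?S \<subseteq> cball z T - ball z R" by (rule closure_minimal[rotated]) auto
    have "has_laplacian_on (\<lambda>y. w y + (- e) * ln (dist z y) + e * ln R) (\<lambda>y. 0 + (- e) * 0 + 0) ?S"
      using R by (intro has_laplacian_on_add has_laplacian_on_cmult has_laplacian_on_const has_laplacian_on_ln_dist
          has_laplacian_on_subset[OF w(1)]) auto
    then have lap: "has_laplacian_on v (\<lambda>y. 0) ?S" by (simp add: v_def[abs_def])
    have cv: "continuous_on (closure ?S) v"
      unfolding v_def using cl R by (intro continuous_intros continuous_on_subset[OF w(2)]) auto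
    have bdv: "v y \<le> 0" if y: "y \<in> frontier ?S" for y
    proof -
      have "y \<in> cball z T - ball z R" "y \<notin> ?S" using y cl S(1) by (auto simp: frontier_def interior_open)
      then consider "dist z y = R" | "dist z y = T" by fastforce
      then show ?thesis
      proof cases
        case 1
        then show ?thesis using bd[of y] by (simp add: v_def)
      next
        case 2
        have "T \<le> norm y + norm z" using norm_triangle_ineq4[of z y] 2 by (simp add: dist_norm)
        then have "w y \<le> M" using T(3) by (intro M) simp
        moreover have "ln (R * exp (M / e)) \<le> ln T" using T R by (subst ln_le_cancel_iff) auto
        then have "ln R + M / e \<le> ln T" using R by (simp add: ln_mult)
        then have "e * (ln R + M / e) \<le> e * ln T" using e by (intro mult_left_mono) auto
        then have "e * ln R + M \<le> e * ln T" using e by (simp add: distrib_left)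
        ultimately show ?thesis using 2 by (simp add: v_def)
      qed
    qed
    show ?thesis
    proof (cases "dist z x = R")
      case True
      then show ?thesis using bd[of x] by (simp add: L_def)
    next
      case False
      then have "x \<in> ?S" using x T(1) by auto
      then have "v x \<le> 0"
        using maximum_principle[OF S lap cv bdv] closure_subset by blast
      then show ?thesis by (simp add: v_def L_def algebra_simps)
    qed
  qed
  have "w x \<le> 0 + e" if e: "e > 0" for e
  proof -
    \<comment> \<open>The added 1 keeps the denominator positive when \<open>x\<close> lies on the
      circle, where \<open>L x = 0\<close>.\<close>
    have "w x \<le> (e / (L x + 1)) * L x" using e L0 by (intro *) auto
    also have "\<dots> \<le> e" using e L0 by (simp add: field_simps)
    finally show ?thesis by simp
  qed
  then show ?thesis by (rule field_le_epsilon)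
qed

lemma exterior_bounded_harmonic_zero:
  fixes w :: "real^2 \<Rightarrow> real"
  assumes R: "R > 0" and w: "has_laplacian_on w (\<lambda>x. 0) (- cball z R)" "continuous_on (- ball z R) w"
    and bd: "\<And>x. x \<in> sphere z R \<Longrightarrow> w x = 0"
    and M: "\<And>x. norm x \<ge> B \<Longrightarrow> \<bar>w x\<bar> \<le> M" and x: "x \<notin> ball z R"
  shows "w x = 0"
proof -
  have "w x \<le> 0"
    using bd M by (intro exterior_bounded_harmonic_nonpos[OF R w _ _ x, of B M]) (auto simp: abs_le_iff)
  moreover have "- 1 * w x \<le> 0"
  proof (rule exterior_bounded_harmonic_nonpos[OF R _ _ _ _ x, of _ B M])
    show "has_laplacian_on (\<lambda>x. - 1 * w x) (\<lambda>x. 0) (- cball z R)"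
      using has_laplacian_on_cmult[OF w(1), of "-1"] by simp
    show "continuous_on (- ball z R) (\<lambda>x. - 1 * w x)" by (intro continuous_intros w)
    show "- 1 * w y \<le> M" if "norm y \<ge> B" for y using M[OF that] by (simp add: abs_le_iff)
  qed (simp add: bd)
  ultimately show ?thesis by simp
qed

text \<open>The logarithmic coefficient refers to the origin, the comparison function to the centre
  \<open>z\<close>. This far out the two distances differ by a factor of at most 2, so the change of
  centre costs a bounded term.\<close>

lemma ln_norm_diff_bounded:
  fixes z :: "'a::real_normed_vector"
  assumes "norm x \<ge> 2 * norm z + 1"
  shows "\<bar>ln (norm x) - ln (dist z x)\<bar> \<le> ln 2"
proof -
  have pos: "norm x > 0" using assms norm_ge_zero[of z] by linarith
  have "dist z x \<le> norm x + norm z" "norm x \<le> dist z x + norm z"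
    using norm_triangle_ineq4[of z x] norm_triangle_sub[of x z] by (auto simp: dist_norm norm_minus_commute)
  then have d: "dist z x \<le> 2 * norm x" "norm x \<le> 2 * dist z x" using assms norm_ge_zero[of z] by linarith+
  have dp: "dist z x > 0" using d pos by linarith
  have "ln (dist z x) \<le> ln (2 * norm x)" using d(1) dp pos by (subst ln_le_cancel_iff) auto
  moreover have "ln (norm x) \<le> ln (2 * dist z x)" using d(2) dp pos by (subst ln_le_cancel_iff) auto
  moreover have "ln (2 * norm x) = ln 2 + ln (norm x)" "ln (2 * dist z x) = ln 2 + ln (dist z x)"
    using pos dp by (auto intro: ln_mult_pos)
  ultimately show ?thesis by linarith
qed

section \<open>The overdetermined problem\<close>

lemma boundary_curvature_constant:
  fixes \<psi>\<^sub>1 \<psi>\<^sub>2 :: "real^2 \<Rightarrow> real"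
  assumes \<Omega>: "open \<Omega>" "connected (frontier \<Omega>)" "Ck_holder_boundary 3 \<alpha> \<Omega>" and "\<beta> > 0"
    and C2: "C2_up_to_boundary \<Omega> \<psi>\<^sub>1" "C2_up_to_boundary (- closure \<Omega>) \<psi>\<^sub>2"
    and lap: "\<And>x. x \<in> \<Omega> \<Longrightarrow> laplacian \<psi>\<^sub>1 x = \<gamma>" "\<And>x. x \<in> - closure \<Omega> \<Longrightarrow> laplacian \<psi>\<^sub>2 x = 0"
    and bd: "\<And>p. p \<in> frontier \<Omega> \<Longrightarrow> \<psi>\<^sub>1 p = 0" "\<And>p. p \<in> frontier \<Omega> \<Longrightarrow> \<psi>\<^sub>2 p = 0"
    and Q: "\<And>p. p \<in> frontier \<Omega> \<Longrightarrow>
           (norm (boundary_value \<Omega> (gradient \<psi>\<^sub>1) p))\<^sup>2 + \<beta> * boundary_curvature \<Omega> p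
             - q * (norm (boundary_value (- closure \<Omega>) (gradient \<psi>\<^sub>2) p))\<^sup>2 = Q"
    and m: "\<And>p. p \<in> frontier \<Omega> \<Longrightarrow> normal_second_derivative \<Omega> \<Omega> \<psi>\<^sub>1 p = m\<^sub>1"
      "\<And>p. p \<in> frontier \<Omega> \<Longrightarrow> normal_second_derivative \<Omega> (- closure \<Omega>) \<psi>\<^sub>2 p = m\<^sub>2"
  obtains \<kappa> where "\<And>p. p \<in> frontier \<Omega> \<Longrightarrow> boundary_curvature \<Omega> p = \<kappa>"
proof -
  let ?P = "[:(\<gamma> - m\<^sub>1)\<^sup>2 - q * m\<^sub>2\<^sup>2, 0, - Q, \<beta>:]"
  have root: "poly ?P (boundary_curvature \<Omega> p) = 0"
    and cont: "continuous (at p within frontier \<Omega>) (boundary_curvature \<Omega>)" if p: "p \<in> frontier \<Omega>" for p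
  proof -
    obtain \<tau> n r \<phi> \<phi>1 \<phi>2 where "graph_chart \<Omega> p \<tau> n r \<phi> \<phi>1 \<phi>2"
      using Ck_holder_boundary_graph_chart[OF \<Omega>(3) p] .
    then interpret graph_chart \<Omega> p \<tau> n r \<phi> \<phi>1 \<phi>2 .
    show "continuous (at p within frontier \<Omega>) (boundary_curvature \<Omega>)"
      using continuous_boundary_curvature[OF p] .
    have pb: "p \<in> ball p r" using r_pos by simp
    have op: "open (- closure \<Omega>)" by (simp add: open_Compl)
    define K where "K = boundary_curvature \<Omega> p"
    have unit: "(norm (k *\<^sub>R outward_normal \<Omega> p))\<^sup>2 = k\<^sup>2" for k
      using outward_normal_properties(1)[OF \<Omega>(3) p] by (simp add: power2_eq_square)
    obtain k1 where k1: "boundary_value \<Omega> (gradient \<psi>\<^sub>1) p = k1 *\<^sub>R outward_normal \<Omega> p" "m\<^sub>1 + K * k1 = \<gamma>"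
      using normal_relation[OF p pb disjI1[OF refl] \<Omega>(1) C2(1) lap(1) bd(1)] m(1)[OF p] unfolding K_def by metis
    obtain k2 where k2: "boundary_value (- closure \<Omega>) (gradient \<psi>\<^sub>2) p = k2 *\<^sub>R outward_normal \<Omega> p" "m\<^sub>2 + K * k2 = 0"
      using normal_relation[OF p pb disjI2[OF refl] op C2(2) lap(2) bd(2)] m(2)[OF p] unfolding K_def by metis
    have "Q = k1\<^sup>2 + \<beta> * K - q * k2\<^sup>2"
      using Q[OF p, symmetric] unfolding k1 k2 unit K_def .
    \<comment> \<open>The unknown normal derivatives \<open>k1\<close>, \<open>k2\<close> occur only
      squared in the Bernoulli condition, so the factor \<open>K\<^sup>2\<close> eliminates both
      without dividing by \<open>K\<close>.\<close>
    moreover have "\<gamma> - m\<^sub>1 = K * k1" "m\<^sub>2 = - (K * k2)" using k1(2) k2(2) by auto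
    ultimately have "(\<gamma> - m\<^sub>1)\<^sup>2 - q * m\<^sub>2\<^sup>2 - Q * K\<^sup>2 + \<beta> * K ^ 3 = 0"
      by (simp only:) (simp add: algebra_simps power2_eq_square power3_eq_cube)
    then show "poly ?P (boundary_curvature \<Omega> p) = 0"
      unfolding K_def[symmetric] by (simp add: algebra_simps power2_eq_square power3_eq_cube)
  qed
  have "?P \<noteq> 0" using \<open>\<beta> > 0\<close> by simp
  then have "finite (boundary_curvature \<Omega> ` frontier \<Omega>)"
    using root by (intro finite_subset[OF _ poly_roots_finite[of ?P]]) auto
  then have "boundary_curvature \<Omega> constant_on frontier \<Omega>"
    using cont \<Omega>(2) by (intro continuous_finite_range_constant) (auto simp: continuous_on_eq_continuous_within)
  then show ?thesis using that unfolding constant_on_def by blast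
qed

lemma radially_symmetric_ball:
  assumes u: "C2_up_to_boundary (ball z R) u" "\<And>x. x \<in> ball z R \<Longrightarrow> laplacian u x = \<gamma>"
    and bd: "\<And>x. x \<in> frontier (ball z R) \<Longrightarrow> u x = 0" and "R > 0"
  shows "radially_symmetric_on (closure (ball z R)) z u"
proof -
  \<comment> \<open>The difference to
    \<open>\<gamma> / 4 * ((dist z x)\<^sup>2 - R\<^sup>2)\<close>; the 4 is the Laplacian of the
    squared distance in the plane.\<close>
  let ?w = "\<lambda>x. u x + (- \<gamma> / 4) * (dist z x)\<^sup>2 + \<gamma> / 4 * R\<^sup>2"
  have cu: "continuous_on (closure (ball z R)) u" using u(1) by (simp add: C2_up_to_boundary_def)
  have "has_laplacian_on ?w (\<lambda>x. \<gamma> + (- \<gamma> / 4) * (2 * DIM(real^2)) + 0) (ball z R)"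
    by (intro has_laplacian_on_add has_laplacian_on_cmult has_laplacian_on_const has_laplacian_on_sqdist
        has_laplacian_on_laplacian u) auto
  then have "has_laplacian_on ?w (\<lambda>x. 0) (ball z R)" by simp
  moreover have "continuous_on (closure (ball z R)) ?w" by (intro continuous_intros cu)
  moreover have "?w x = 0" if "x \<in> frontier (ball z R)" for x
    using bd[OF that] that \<open>R > 0\<close> by simp
  ultimately have "?w x = 0" if "x \<in> closure (ball z R)" for x
    using harmonic_zero_boundary[OF open_ball bounded_ball] that by blast
  then have "\<forall>x\<in>closure (ball z R). u x = \<gamma> / 4 * (dist z x)\<^sup>2 - \<gamma> / 4 * R\<^sup>2" by fastforce
  then show ?thesis unfolding radially_symmetric_on_def by (intro exI)
qed

lemma radially_symmetric_exterior:
  assumes u: "C2_up_to_boundary (- cball z R) u" "\<And>x. x \<in> - cball z R \<Longrightarrow> laplacian u x = 0"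
    and bd: "\<And>x. x \<in> sphere z R \<Longrightarrow> u x = 0" and R: "R > 0"
    and a: "(\<lambda>x. u x - a * ln (norm x)) \<in> O[at_infinity](\<lambda>_. 1)"
  shows "radially_symmetric_on (- ball z R) z u"
proof -
  \<comment> \<open>The difference to \<open>a * ln (dist z x / R)\<close>, which is harmonic,
    vanishes on the circle and has the same logarithmic coefficient, so that \<open>?w\<close> stays
    bounded at infinity.\<close>
  let ?w = "\<lambda>x. u x + (- a) * ln (dist z x) + a * ln R"
  have "closure (- cball z R) = - ball z R" by (simp add: closure_complement)
  then have cu: "continuous_on (- ball z R) u" using u(1) by (simp add: C2_up_to_boundary_def)
  have "has_laplacian_on ?w (\<lambda>x. 0 + (- a) * 0 + 0) (- cball z R)"
    using R by (intro has_laplacian_on_add has_laplacian_on_cmult has_laplacian_on_const has_laplacian_on_ln_dist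
        has_laplacian_on_laplacian u) auto
  then have lap: "has_laplacian_on ?w (\<lambda>x. 0) (- cball z R)" by simp
  have cw: "continuous_on (- ball z R) ?w" using R by (intro continuous_intros cu) auto
  have w0: "?w x = 0" if "x \<in> sphere z R" for x using bd[OF that] that by simp
  obtain c where "\<forall>\<^sub>F x in at_infinity. norm (u x - a * ln (norm x)) \<le> c * norm (1::real)"
    using a by (elim landau_o.bigE)
  then obtain b where b: "\<And>x. norm x \<ge> b \<Longrightarrow> \<bar>u x - a * ln (norm x)\<bar> \<le> c"
    by (auto simp: eventually_at_infinity)
  have M: "\<bar>?w x\<bar> \<le> c + \<bar>a\<bar> * ln 2 + \<bar>a * ln R\<bar>" if x: "norm x \<ge> max b (2 * norm z + 1)" for x
  proof -
    have "\<bar>a * (ln (norm x) - ln (dist z x))\<bar> \<le> \<bar>a\<bar> * ln 2"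
      unfolding abs_mult using x by (intro mult_left_mono ln_norm_diff_bounded) auto
    moreover have "?w x = (u x - a * ln (norm x)) + a * (ln (norm x) - ln (dist z x)) + a * ln R"
      by (simp add: algebra_simps)
    ultimately show ?thesis using b[of x] x by linarith
  qed
  have "?w x = 0" if "x \<in> - ball z R" for x
    using that exterior_bounded_harmonic_zero[OF R lap cw w0, where B = "max b (2 * norm z + 1)", OF _ M] by blast
  then have "\<forall>x\<in>- ball z R. u x = a * ln (dist z x) - a * ln R" by fastforce
  then show ?thesis unfolding radially_symmetric_on_def by (intro exI)
qed

theorem theorem1p6:
  fixes \<Omega> :: "(real^2) set"
    and \<psi>\<^sub>1 \<psi>\<^sub>2 :: "real^2 \<Rightarrow> real"
    and \<alpha> \<gamma> Q \<beta> q m\<^sub>1 m\<^sub>2 :: real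
  assumes "0 < \<alpha>" "\<alpha> < 1"
    and "open \<Omega>" "\<Omega> \<noteq> {}" "bounded \<Omega>" "connected \<Omega>" "simply_connected \<Omega>"
    and "connected (frontier \<Omega>)" "Ck_holder_boundary 3 \<alpha> \<Omega>"
    and "\<beta> > 0" "q > 0"
    and "C2_up_to_boundary \<Omega> \<psi>\<^sub>1" "C2_up_to_boundary (- closure \<Omega>) \<psi>\<^sub>2"
    and "\<forall>x\<in>\<Omega>. laplacian \<psi>\<^sub>1 x = \<gamma>"
    and "\<forall>x\<in>- closure \<Omega>. laplacian \<psi>\<^sub>2 x = 0"
    and "\<forall>p\<in>frontier \<Omega>. \<psi>\<^sub>1 p = 0 \<and> \<psi>\<^sub>2 p = 0"
    and "\<forall>p\<in>frontier \<Omega>.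
           (norm (boundary_value \<Omega> (gradient \<psi>\<^sub>1) p))\<^sup>2 + \<beta> * boundary_curvature \<Omega> p
             - q * (norm (boundary_value (- closure \<Omega>) (gradient \<psi>\<^sub>2) p))\<^sup>2 = Q"
    and "((\<lambda>x. norm (gradient \<psi>\<^sub>2 x)) \<longlongrightarrow> 0) at_infinity"
    and "\<forall>p\<in>frontier \<Omega>. normal_second_derivative \<Omega> \<Omega> \<psi>\<^sub>1 p = m\<^sub>1"
    and "\<forall>p\<in>frontier \<Omega>. normal_second_derivative \<Omega> (- closure \<Omega>) \<psi>\<^sub>2 p = m\<^sub>2"
  shows "(\<exists>\<kappa>. \<forall>p\<in>frontier \<Omega>. boundary_curvature \<Omega> p = \<kappa>) \<and>
         (\<exists>z R. R > 0 \<and> \<Omega> = ball z R \<and>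
            radially_symmetric_on (closure \<Omega>) z \<psi>\<^sub>1 \<and>
            (\<forall>a. (\<lambda>x. \<psi>\<^sub>2 x - a * ln (norm x)) \<in> O[at_infinity](\<lambda>_. 1) \<longrightarrow>
                 radially_symmetric_on (- \<Omega>) z \<psi>\<^sub>2))"
proof -
  obtain \<kappa> where \<kappa>: "\<And>p. p \<in> frontier \<Omega> \<Longrightarrow> boundary_curvature \<Omega> p = \<kappa>"
    using boundary_curvature_constant[OF \<open>open \<Omega>\<close> \<open>connected (frontier \<Omega>)\<close> \<open>Ck_holder_boundary 3 \<alpha> \<Omega>\<close>
        \<open>\<beta> > 0\<close> \<open>C2_up_to_boundary \<Omega> \<psi>\<^sub>1\<close> \<open>C2_up_to_boundary (- closure \<Omega>) \<psi>\<^sub>2\<close>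
        assms(14,15)[rule_format] assms(16)[rule_format, THEN conjunct1] assms(16)[rule_format, THEN conjunct2]
        assms(17,19,20)[rule_format]]
    by blast
  obtain z R where R: "R > 0" and ball: "\<Omega> = ball z R"
    using constant_curvature_imp_ball[OF \<open>open \<Omega>\<close> \<open>\<Omega> \<noteq> {}\<close> \<open>bounded \<Omega>\<close> \<open>connected \<Omega>\<close>
        \<open>connected (frontier \<Omega>)\<close> \<open>Ck_holder_boundary 3 \<alpha> \<Omega>\<close> \<kappa>] by blast
  have cl: "closure \<Omega> = cball z R" and fr: "frontier \<Omega> = sphere z R" using R ball by auto
  have in_sym: "radially_symmetric_on (closure \<Omega>) z \<psi>\<^sub>1"
    using assms(12,14,16) R unfolding ball by (intro radially_symmetric_ball[where \<gamma> = \<gamma>]) auto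
  \<comment> \<open>Here \<open>a\<close> is arbitrary: symmetry holds for whichever coefficient the
    expansion of \<open>\<psi>\<^sub>2\<close> has.\<close>
  have out_sym: "radially_symmetric_on (- \<Omega>) z \<psi>\<^sub>2"
    if "(\<lambda>x. \<psi>\<^sub>2 x - a * ln (norm x)) \<in> O[at_infinity](\<lambda>_. 1)" for a
    using assms(13,15,16) R that unfolding cl fr unfolding ball by (intro radially_symmetric_exterior) auto
  show ?thesis
  proof (intro conjI exI allI impI ballI)
    show "boundary_curvature \<Omega> p = \<kappa>" if "p \<in> frontier \<Omega>" for p by (rule \<kappa>[OF that])
  qed (fact R ball in_sym out_sym)+
qed

end
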